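(* Let $G=\prod_{i=1}^t G_i$, where $G_i=\mathbb{Z}_{p_i}\wr Sym_{n_i}$ for each $i$, each $p_i$ is an odd prime, and each $Sym_{n_i}$ acts naturally on $\{1,\dots,n_i\}$. Write $G_i=V_i\rtimes B_i$ with $V_i=(\mathbb{Z}_{p_i})^{n_i}$ the base of the wreath product and $B_i=Sym_{n_i}$. Let $\pi_i:G\to G_i$ be the projections, let $\overline{\phantom{x}}^{\,i}:G_i\to B_i$ be the natural epimorphisms with kernel $V_i$, and let $\overline{\phantom{x}}:G\to B=\prod_{i=1}^t B_i$ be the natural epimorphism with kernel $V=\prod_{i=1}^t V_i$. Let $H$ be a (non-trivial) subgroup of odd index of $G$ such that $\overline{\pi_i(H)}^{\,i}$ is a primitive subgroup of $Sym_{n_i}$ for each $i\in\{1,\dots,t\}$. Then the following statements hold: (i) $\overline{H}=\prod_{i=1}^t Sym_{n_i}$; (ii) for any $K\le G$ such that $H\le K$, $H$ is pronormal in $K$ if and only if $\pi_i(H)$ is pronormal in $\pi_i(K)$ for each $i\in\{1,\dots,t\}$; and (iii) if $t=1$ (put $p=p_1$, $n=n_1$, and let $V^-=\{(x_1,\dots,x_n)\in V\mid \sum_{i=1}^n x_i=0\}$), then the following statements hold: (1) if $p$ does not divide $n$, then $H$ is pronormal in $G$; (2) if $p$ divides $n$, then $H$ is pronormal in $G$ if and only if $V^-\le H$; (3) if $H\le K<G$, then $H$ is pronormal in $K$.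
   Context: A subgroup $H$ of a finite group $G$ is pronormal in $G$ if for every $g\in G$ the subgroups $H$ and $H^g=g^{-1}Hg$ are conjugate in $\langle H,H^g\rangle$. $\mathbb{Z}_p$ is the cyclic group of order $p$, written additively; $Sym_n$ is the symmetric group of degree $n$. In $\mathbb{Z}_p\wr Sym_n=V\rtimes Sym_n$, with $V=(\mathbb{Z}_p)^n$, the group $Sym_n$ permutes the coordinates. $K<G$ means that $K$ is a proper subgroup of $G$. The natural epimorphism $V\rtimes B\to B$ sends $vb$ ($v\in V$, $b\in B$) to $b$. *)

theory Defs
  imports
    "HOL-Algebra.Sym_Groups"
    "HOL-Algebra.Product_Groups"
    "HOL-Algebra.Elementary_Groups"
    "HOL-Algebra.FiniteProduct"
    "HOL-Computational_Algebra.Primes"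
begin

text \<open>The conjugate \<open>H\<^sup>g = g\<inverse> H g\<close>.\<close>

definition conj_set :: "('a, 'b) monoid_scheme \<Rightarrow> 'a set \<Rightarrow> 'a \<Rightarrow> 'a set"
  where "conj_set G H g = (\<lambda>h. inv\<^bsub>G\<^esub> g \<otimes>\<^bsub>G\<^esub> h \<otimes>\<^bsub>G\<^esub> g) ` H"

definition pronormal :: "'a set \<Rightarrow> ('a, 'b) monoid_scheme \<Rightarrow> bool"
  where "pronormal H G \<longleftrightarrow> subgroup H G \<and>
    (\<forall>g \<in> carrier G. \<exists>x \<in> generate G (H \<union> conj_set G H g). conj_set G H x = conj_set G H g)"

text \<open>The semidirect product of \<open>V\<close> and \<open>B\<close>, where \<open>B\<close> acts on the left of \<open>V\<close> through \<open>act\<close>.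
  The pair \<open>(v, b)\<close> is the product \<open>vb\<close>, so the natural epimorphism onto \<open>B\<close> is \<open>snd\<close>.\<close>

definition semidirect_product ::
  "('v, 'x) monoid_scheme \<Rightarrow> ('b, 'y) monoid_scheme \<Rightarrow> ('b \<Rightarrow> 'v \<Rightarrow> 'v) \<Rightarrow> ('v \<times> 'b) monoid"
  where "semidirect_product V B act =
    \<lparr>carrier = carrier V \<times> carrier B,
     monoid.mult = (\<lambda>(v, b) (w, c). (v \<otimes>\<^bsub>V\<^esub> act b w, b \<otimes>\<^bsub>B\<^esub> c)),
     one = (\<one>\<^bsub>V\<^esub>, \<one>\<^bsub>B\<^esub>)\<rparr>"

definition wreath_base :: "nat \<Rightarrow> nat \<Rightarrow> (nat \<Rightarrow> int) monoid"
  where "wreath_base p n = product_group {1..n} (\<lambda>_. integer_mod_group p)"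

text \<open>The coordinate at position \<open>k\<close> is moved to position \<open>b k\<close>. As permutations are composed from
  right to left in \<^const>\<open>sym_group\<close>, the inverse makes this a left action.\<close>

definition permute_coords :: "nat \<Rightarrow> (nat \<Rightarrow> nat) \<Rightarrow> (nat \<Rightarrow> int) \<Rightarrow> nat \<Rightarrow> int"
  where "permute_coords n b v = (\<lambda>k\<in>{1..n}. v (inv' b k))"

definition wreath_sym :: "nat \<Rightarrow> nat \<Rightarrow> ((nat \<Rightarrow> int) \<times> (nat \<Rightarrow> nat)) monoid"
  where "wreath_sym p n = semidirect_product (wreath_base p n) (sym_group n) (permute_coords n)"

text \<open>The subgroup \<open>V\<^sup>-\<close> of the base; since \<^const>\<open>integer_mod_group\<close> is a multiplicative record,
  the sum of the coordinates modulo \<open>p\<close> is a \<^const>\<open>finprod\<close>.\<close>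

definition wreath_base_minus :: "nat \<Rightarrow> nat \<Rightarrow> ((nat \<Rightarrow> int) \<times> (nat \<Rightarrow> nat)) set"
  where "wreath_base_minus p n =
    {x \<in> carrier (wreath_base p n). finprod (integer_mod_group p) x {1..n} = \<one>\<^bsub>integer_mod_group p\<^esub>}
      \<times> {\<one>\<^bsub>sym_group n\<^esub>}"

text \<open>Primitive means transitive without non-trivial blocks; the trivial group of degree 1 is
  primitive, the trivial group of degree 2 is not.\<close>

definition primitive_subgroup :: "(nat \<Rightarrow> nat) set \<Rightarrow> nat \<Rightarrow> bool"
  where "primitive_subgroup P n \<longleftrightarrow>
    subgroup P (sym_group n) \<and>
    (\<forall>x \<in> {1..n}. \<forall>y \<in> {1..n}. \<exists>g \<in> P. g x = y) \<and>
    (\<forall>D \<subseteq> {1..n}. D \<noteq> {} \<and> (\<forall>g \<in> P. g ` D = D \<or> g ` D \<inter> D = {}) \<longrightarrow>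
       is_singleton D \<or> D = {1..n})"

end

theory Submission
  imports Defs "HOL-Algebra.Zassenhaus" "HOL-Number_Theory.Cong"
begin

text \<open>
  Let \<open>V\<^sub>i\<close> be the base of the \<open>i\<close>-th wreath product, viewed as the permutation module of
  \<open>Sym\<^sub>n\<close> over the field with \<open>p\<close> elements (with \<open>p = p\<^sub>i\<close> and \<open>n = n\<^sub>i\<close>), and let
  \<open>V\<^sub>i\<^sup>-\<close> be its submodule of vectors with coordinate sum 0.

  First, \<open>H\<close> maps onto the product of the symmetric groups. An involution permutes the odd number
  of cosets of \<open>H\<close>, so it fixes one, and a conjugate of it lies in \<open>H\<close>. For an involution that is a
  transposition in one factor and trivial in the others, this puts a transposition of that factor
  into the image of \<open>H\<close>. The image projects onto a primitive group in that factor, so Jordan's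
  argument gives the whole symmetric group of the factor. Hence \<open>G = H V\<close>, and in testing whether
  \<open>H\<close> is pronormal in \<open>K\<close> it suffices to conjugate by elements of \<open>K \<inter> V\<close>.

  Everything else rests on one computation. Let \<open>v \<in> V\<close> have a non-constant \<open>i\<close>-th component, and let
  \<open>h \<in> H\<close> lie over a transposition \<open>(k l)\<close> of the \<open>i\<close>-th factor. The commutator of \<open>h\<close> and \<open>v\<close> is a
  multiple of \<open>e\<^sub>k - e\<^sub>l\<close> in \<open>V\<^sub>i\<close>, and for suitable \<open>k, l\<close> a nonzero one. As \<open>p\<close> is prime, its
  multiples and their images under \<open>Sym\<^sub>n\<close> generate \<open>V\<^sub>i\<^sup>-\<close>
  (\<open>zero_sum_vectors_subset_by_commutators\<close>, \<open>zero_sum_subset_by_commutators\<close>). Therefore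
  \<open>\<langle>H, H\<^sup>v\<rangle>\<close> contains \<open>V\<^sub>i\<^sup>-\<close> whenever \<open>v\<^sub>i\<close> is not constant.

  This gives a sufficient condition (\<open>pronormal_element_exists\<close>). Suppose that for each \<open>i\<close> either
  \<open>v\<^sub>i\<close> lies in \<open>V\<^sub>i\<^sup>-\<close> plus the constant vectors, or \<open>V\<^sub>i\<^sup>- \<le> H\<close>. Then \<open>v = y x\<close>, where \<open>x\<close> is in
  \<open>\<langle>H, H\<^sup>v\<rangle>\<close> and \<open>y\<close> normalises \<open>H\<close>: constant vectors are central, and if \<open>V\<^sub>i\<^sup>- \<le> H\<close> then all of \<open>V\<^sub>i\<close>
  normalises \<open>H\<close>, because commutators with elements of \<open>V\<^sub>i\<close> have sum 0. So \<open>H\<^sup>v = H\<^sup>x\<close>. If \<open>p\<close> does not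
  divide \<open>n\<close>, every vector is in \<open>V\<^sub>i\<^sup>-\<close> plus the constants.

  If \<open>p\<close> divides \<open>n\<close>, the condition is also necessary (\<open>pronormal_element_forces_zero_sum\<close>). Take a
  single factor, \<open>v\<close> outside \<open>V\<^sup>-\<close>, and \<open>x \<in> \<langle>H, H\<^sup>v\<rangle> \<le> H V\<^sup>-\<close> with \<open>H\<^sup>x = H\<^sup>v\<close>. Writing \<open>x = h w\<close> with
  \<open>w \<in> V\<^sup>-\<close>, the element \<open>v - w\<close> normalises \<open>H\<close> and still has nonzero sum, so it is not constant,
  and its commutators with \<open>H\<close>, which lie in \<open>H\<close>, generate \<open>V\<^sup>-\<close>.

  For the product, pronormality of \<open>H\<close> passes to the projections because it is preserved by
  homomorphisms. Conversely, if the projections are pronormal and some \<open>v\<^sub>i\<close> with \<open>p\<close> dividing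
  \<open>n\<close> is outside \<open>V\<^sub>i\<^sup>-\<close>, the necessary condition shows that the projection of \<open>H\<close> contains
  \<open>V\<^sub>i\<^sup>-\<close>; one more commutator, for which \<open>p\<close> has to be odd, moves \<open>V\<^sub>i\<^sup>-\<close> into \<open>H\<close> itself. The last
  claim for \<open>t = 1\<close> holds because a subgroup above \<open>H\<close> that contains a vector outside \<open>V\<^sup>-\<close> contains
  \<open>V\<^sup>-\<close>, which has index \<open>p\<close> in \<open>V\<close>, and so is all of \<open>G\<close>.
\<close>

section \<open>Conjugates and pronormal subgroups\<close>

context group
begin

lemma conj_set_subset_carrier:
  assumes "H \<subseteq> carrier G" "g \<in> carrier G"
  shows "conj_set G H g \<subseteq> carrier G"
  using assms by (auto simp: conj_set_def)

lemma conj_set_mult: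
  assumes "H \<subseteq> carrier G" "x \<in> carrier G" "y \<in> carrier G"
  shows "conj_set G H (x \<otimes> y) = conj_set G (conj_set G H x) y"
proof -
  have "inv (x \<otimes> y) \<otimes> h \<otimes> (x \<otimes> y) = inv y \<otimes> (inv x \<otimes> h \<otimes> x) \<otimes> y" if "h \<in> carrier G" for h
    using assms that by (simp add: inv_mult_group m_assoc)
  then show ?thesis
    using assms(1) unfolding conj_set_def image_image by (intro image_cong) auto
qed

lemma conj_set_one:
  assumes "H \<subseteq> carrier G"
  shows "conj_set G H \<one> = H"
proof -
  have "conj_set G H \<one> = (\<lambda>h. h) ` H"
    unfolding conj_set_def using assms by (intro image_cong) auto
  then show ?thesis by simp
qed

lemma conj_set_self:
  assumes H: "subgroup H G" and h: "h \<in> H"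
  shows "conj_set G H h = H"
proof
  have sub: "conj_set G H x \<subseteq> H" if "x \<in> H" for x
    using subgroup.m_closed[OF H] subgroup.m_inv_closed[OF H] that by (auto simp: conj_set_def)
  show "conj_set G H h \<subseteq> H" using h by (rule sub)
  have hG: "h \<in> carrier G" "H \<subseteq> carrier G"
    using h subgroup.subset[OF H] by auto
  have "H = conj_set G (conj_set G H (inv h)) h"
    using conj_set_mult[of H "inv h" h] hG by (simp add: conj_set_one)
  also have "\<dots> \<subseteq> conj_set G H h"
    using sub[OF subgroup.m_inv_closed[OF H h]] by (auto simp: conj_set_def)
  finally show "H \<subseteq> conj_set G H h" .
qed

text \<open>The normaliser of \<open>H\<close>, for the right action \<open>H \<mapsto> H\<^sup>g\<close>.\<close>

lemma subgroup_conj_stabilizer: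
  assumes H: "H \<subseteq> carrier G"
  shows "subgroup {y \<in> carrier G. conj_set G H y = H} G"
proof (rule subgroupI)
  show "{y \<in> carrier G. conj_set G H y = H} \<noteq> {}"
    using conj_set_one[OF H] by blast
  fix y assume y: "y \<in> {y \<in> carrier G. conj_set G H y = H}"
  then have "conj_set G H (y \<otimes> inv y) = conj_set G H (inv y)"
    by (subst conj_set_mult) (use H in auto)
  then show "inv y \<in> {y \<in> carrier G. conj_set G H y = H}"
    using y H by (simp add: conj_set_one)
next
  fix y z
  assume "y \<in> {y \<in> carrier G. conj_set G H y = H}" "z \<in> {y \<in> carrier G. conj_set G H y = H}"
  then show "y \<otimes> z \<in> {y \<in> carrier G. conj_set G H y = H}"
    using H by (simp add: conj_set_mult)
qed auto

text \<open>Conjugates and generated subgroups of subsets of \<open>K\<close> are the same in \<open>K\<close> and in the ambient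
  group, so all later arguments can be carried out in the ambient group.\<close>

lemma pronormal_in_subgroup_iff:
  assumes K: "subgroup K G"
  shows "pronormal H (G\<lparr>carrier := K\<rparr>) \<longleftrightarrow>
    subgroup H G \<and> H \<subseteq> K \<and>
    (\<forall>g\<in>K. \<exists>x\<in>generate G (H \<union> conj_set G H g). conj_set G H x = conj_set G H g)"
proof -
  have conj: "conj_set (G\<lparr>carrier := K\<rparr>) H x = conj_set G H x" if "x \<in> K" for x
    using that K by (simp add: conj_set_def)
  have closed: "conj_set G H g \<subseteq> K" if "H \<subseteq> K" "g \<in> K" for g
    using subgroup.m_closed[OF K] subgroup.m_inv_closed[OF K] that by (auto simp: conj_set_def)
  have sub: "subgroup H (G\<lparr>carrier := K\<rparr>) \<longleftrightarrow> subgroup H G \<and> H \<subseteq> K"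
    using incl_subgroup[OF K] subgroup_incl[OF _ K] subgroup.subset by fastforce
  have gen: "generate (G\<lparr>carrier := K\<rparr>) (H \<union> conj_set G H g) = generate G (H \<union> conj_set G H g)"
    "generate G (H \<union> conj_set G H g) \<subseteq> K"
    if "H \<subseteq> K" "g \<in> K" for g
    using generate_consistent[OF _ K] generate_subgroup_incl[OF _ K] closed[OF that] that by auto
  have "(\<forall>g\<in>K. \<exists>x\<in>generate (G\<lparr>carrier := K\<rparr>) (H \<union> conj_set (G\<lparr>carrier := K\<rparr>) H g).
      conj_set (G\<lparr>carrier := K\<rparr>) H x = conj_set (G\<lparr>carrier := K\<rparr>) H g) \<longleftrightarrow>
    (\<forall>g\<in>K. \<exists>x\<in>generate G (H \<union> conj_set G H g). conj_set G H x = conj_set G H g)" if HK: "H \<subseteq> K"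
  proof (rule ball_cong[OF refl])
    fix g assume g: "g \<in> K"
    show "(\<exists>x\<in>generate (G\<lparr>carrier := K\<rparr>) (H \<union> conj_set (G\<lparr>carrier := K\<rparr>) H g).
        conj_set (G\<lparr>carrier := K\<rparr>) H x = conj_set (G\<lparr>carrier := K\<rparr>) H g) \<longleftrightarrow>
      (\<exists>x\<in>generate G (H \<union> conj_set G H g). conj_set G H x = conj_set G H g)"
      unfolding conj[OF g] gen(1)[OF HK g]
      by (rule bex_cong[OF refl]) (use gen(2)[OF HK g] conj in auto)
  qed
  then show ?thesis
    unfolding pronormal_def sub by auto
qed

text \<open>Right multiplication by \<open>s\<close> is an involution of the odd number of right cosets of \<open>H\<close>, so
  it fixes some coset \<open>H a\<close>; then \<open>a s a\<inverse>\<close> lies in \<open>H\<close>.\<close>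

lemma involution_conj_in_odd_index_subgroup:
  assumes H: "subgroup H G" and odd: "odd (card (rcosets H))"
    and s: "s \<in> carrier G" "s \<otimes> s = \<one>"
  shows "\<exists>g\<in>carrier G. g \<otimes> s \<otimes> inv g \<in> H"
proof -
  have fixed_point: "\<exists>x\<in>A. f x = x" if "odd (card A)" "\<And>x. x \<in> A \<Longrightarrow> f x \<in> A \<and> f (f x) = x"
    for A :: "'a set set" and f
    using that
  proof (induction "card A" arbitrary: A rule: less_induct)
    case less
    then obtain x where x: "x \<in> A" by (metis card.empty even_zero ex_in_conv)
    have fin: "finite A" using less.prems(1) by (metis card.infinite even_zero)
    show ?case
    proof (cases "f x = x")
      case False
      have two: "card {x, f x} = 2" "{x, f x} \<subseteq> A" using False x less.prems(2) by auto
      have card: "card (A - {x, f x}) = card A - 2"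
        using two fin by (simp add: card_Diff_subset)
      moreover have "2 \<le> card A" using two card_mono[OF fin] by metis
      ultimately have smaller: "card (A - {x, f x}) < card A" "odd (card (A - {x, f x}))"
        using less.prems(1) by auto
      have "f y \<in> A - {x, f x} \<and> f (f y) = y" if y: "y \<in> A - {x, f x}" for y
      proof -
        have "f y \<noteq> x" "f y \<noteq> f x"
          using y x less.prems(2)[of x] less.prems(2)[of y] by auto
        then show ?thesis using y less.prems(2)[of y] by auto
      qed
      then show ?thesis
        using less.hyps[OF smaller] by blast
    qed (use x in blast)
  qed
  have HG: "H \<subseteq> carrier G" using H by (rule subgroup.subset)
  have "\<exists>C\<in>rcosets H. C #> s = C"
  proof (rule fixed_point[OF odd])
    fix C assume "C \<in> rcosets H"
    then obtain a where a: "a \<in> carrier G" "C = H #> a" by (auto simp: RCOSETS_def)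
    then show "C #> s \<in> rcosets H \<and> C #> s #> s = C"
      using s HG by (auto simp: coset_mult_assoc m_assoc r_coset_subset_G intro!: rcosetsI)
  qed
  then obtain a where a: "a \<in> carrier G" "H #> a #> s = H #> a" by (auto simp: RCOSETS_def)
  then have "a \<otimes> s \<in> H #> a"
    using repr_independenceD[OF H] rcos_self[OF _ H, of "a \<otimes> s"] s HG
    by (simp add: coset_mult_assoc)
  then have "a \<otimes> s \<otimes> inv a \<in> H"
    using subgroup.rcos_module_imp[OF H is_group] a by blast
  then show ?thesis using a(1) by blast
qed

end

lemma (in group_hom) conj_set_img:
  assumes "A \<subseteq> carrier G" "g \<in> carrier G"
  shows "conj_set H (h ` A) (h g) = h ` conj_set G A g"
  unfolding conj_set_def image_image using assms by (intro image_cong) (auto simp: subset_iff)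

lemma (in group_hom) pronormal_img:
  assumes K: "subgroup K G" and pro: "pronormal A (G\<lparr>carrier := K\<rparr>)"
  shows "pronormal (h ` A) (H\<lparr>carrier := h ` K\<rparr>)"
proof -
  have A: "subgroup A G" "A \<subseteq> K"
    and ex: "\<And>g. g \<in> K \<Longrightarrow> \<exists>x\<in>generate G (A \<union> conj_set G A g). conj_set G A x = conj_set G A g"
    using pro G.pronormal_in_subgroup_iff[OF K] by auto
  have KG: "K \<subseteq> carrier G" "A \<subseteq> carrier G" using K A(1) by (auto dest: subgroup.subset)
  have "\<exists>x\<in>generate H (h ` A \<union> conj_set H (h ` A) (h g)).
      conj_set H (h ` A) x = conj_set H (h ` A) (h g)" if g: "g \<in> K" for g
  proof -
    obtain x where x: "x \<in> generate G (A \<union> conj_set G A g)" "conj_set G A x = conj_set G A g"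
      using ex[OF g] by blast
    have gG: "g \<in> carrier G" using g KG by blast
    have AgG: "A \<union> conj_set G A g \<subseteq> carrier G"
      using KG gG G.conj_set_subset_carrier by blast
    have "h x \<in> generate H (h ` A \<union> conj_set H (h ` A) (h g))"
      using x(1) generate_img[OF AgG] conj_set_img[OF KG(2) gG] by (auto simp: image_Un)
    moreover have "conj_set H (h ` A) (h x) = conj_set H (h ` A) (h g)"
      using x conj_set_img KG(2) gG G.generate_incl[OF AgG] by auto
    ultimately show ?thesis by blast
  qed
  then show ?thesis
    using H.pronormal_in_subgroup_iff[OF subgroup_img_is_subgroup[OF K]]
      subgroup_img_is_subgroup[OF A(1)] A(2) by auto
qed

lemma (in group_hom) subgroup_preimage:
  assumes "subgroup S H"
  shows "subgroup {x \<in> carrier G. h x \<in> S} G"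
proof (rule G.subgroupI)
  show "{x \<in> carrier G. h x \<in> S} \<noteq> {}"
    using subgroup.one_closed[OF assms] hom_one by (metis (mono_tags, lifting) G.one_closed empty_iff mem_Collect_eq)
qed (use assms in \<open>auto simp: subgroup.m_closed subgroup.m_inv_closed\<close>)

section \<open>Arithmetic in the wreath product\<close>

text \<open>The vector of residues of an integer-valued function. Writing all base elements in this form
  replaces reductions modulo \<open>p\<close> inside the group operations by integer arithmetic and a congruence
  at the end.\<close>

definition residue_vector :: "nat \<Rightarrow> nat \<Rightarrow> (nat \<Rightarrow> int) \<Rightarrow> nat \<Rightarrow> int"
  where "residue_vector p n f = (\<lambda>k\<in>{1..n}. f k mod int p)"

text \<open>The submodule \<open>V\<^sup>-\<close> as a subset of the base; \<^const>\<open>wreath_base_minus\<close> is its copy inside the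
  wreath product.\<close>

definition zero_sum_vectors :: "nat \<Rightarrow> nat \<Rightarrow> (nat \<Rightarrow> int) set"
  where "zero_sum_vectors p n = {x \<in> carrier (wreath_base p n).
    finprod (integer_mod_group p) x {1..n} = \<one>\<^bsub>integer_mod_group p\<^esub>}"

lemma residue_vector_eq_iff:
  "residue_vector p n f = residue_vector p n g \<longleftrightarrow> (\<forall>k\<in>{1..n}. [f k = g k] (mod int p))"
  by (auto simp: residue_vector_def restrict_def fun_eq_iff cong_def)

context
  fixes p n :: nat
  assumes p_pos: "0 < p"
begin

lemma group_wreath_base: "group (wreath_base p n)"
  by (simp add: wreath_base_def)

lemma residue_vector_in_carrier [simp]: "residue_vector p n f \<in> carrier (wreath_base p n)"
  using p_pos by (auto simp: wreath_base_def residue_vector_def carrier_integer_mod_group)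

lemma residue_vector_carrier: "v \<in> carrier (wreath_base p n) \<Longrightarrow> residue_vector p n v = v"
  using p_pos
  by (fastforce simp: wreath_base_def residue_vector_def carrier_integer_mod_group PiE_iff
      extensional_def restrict_def fun_eq_iff)

lemma wreath_base_one: "\<one>\<^bsub>wreath_base p n\<^esub> = residue_vector p n (\<lambda>_. 0)"
  by (auto simp: wreath_base_def residue_vector_def)

lemma wreath_base_mult:
  "residue_vector p n f \<otimes>\<^bsub>wreath_base p n\<^esub> residue_vector p n g = residue_vector p n (\<lambda>k. f k + g k)"
  by (auto simp: wreath_base_def residue_vector_def mod_simps restrict_def)

lemma permute_residue_vector:
  assumes "a permutes {1..n}"
  shows "permute_coords n a (residue_vector p n f) = residue_vector p n (\<lambda>k. f (inv' a k))"
proof -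
  have "inv' a k \<in> {1..n}" if "k \<in> {1..n}" for k
    using permutes_in_image[OF permutes_inv[OF assms], of k] that by blast
  then show ?thesis
    unfolding permute_coords_def residue_vector_def by (intro restrict_ext) simp
qed

lemma zero_sum_residue_vector_iff:
  "residue_vector p n f \<in> zero_sum_vectors p n \<longleftrightarrow> int p dvd (\<Sum>k=1..n. f k)"
proof -
  interpret Z: comm_group "integer_mod_group p" by simp
  have "finprod (integer_mod_group p) (residue_vector p n f) A = (\<Sum>k\<in>A. f k) mod int p"
    if "finite A" "A \<subseteq> {1..n}" for A
    using that
  proof (induction A)
    case (insert k A)
    have "residue_vector p n f \<in> insert k A \<rightarrow> carrier (integer_mod_group p)"
      using insert.prems p_pos by (auto simp: residue_vector_def carrier_integer_mod_group)
    moreover have "residue_vector p n f k = f k mod int p"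
      using insert.prems by (simp add: residue_vector_def)
    ultimately show ?case
      using insert by (simp add: Z.finprod_insert Pi_iff mod_simps)
  qed simp
  then show ?thesis
    by (simp add: zero_sum_vectors_def dvd_eq_mod_eq_0)
qed

lemma carrier_wreath_sym:
  "carrier (wreath_sym p n) = carrier (wreath_base p n) \<times> {a. a permutes {1..n}}"
  by (simp add: wreath_sym_def semidirect_product_def sym_group_def)

lemma wreath_sym_elem:
  assumes "x \<in> carrier (wreath_sym p n)"
  obtains f a where "x = (residue_vector p n f, a)" "a permutes {1..n}"
proof -
  obtain v a where v: "x = (v, a)" "v \<in> carrier (wreath_base p n)" "a permutes {1..n}"
    using assms by (auto simp: carrier_wreath_sym)
  then show thesis
    using that[of v a] residue_vector_carrier[of v] by simp
qed

lemma wreath_sym_one: "\<one>\<^bsub>wreath_sym p n\<^esub> = (residue_vector p n (\<lambda>_. 0), id)"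
  by (simp add: wreath_sym_def semidirect_product_def wreath_base_one sym_group_def)

lemma wreath_sym_mult:
  assumes "a permutes {1..n}"
  shows "(residue_vector p n f, a) \<otimes>\<^bsub>wreath_sym p n\<^esub> (residue_vector p n g, b) =
    (residue_vector p n (\<lambda>k. f k + g (inv' a k)), a \<circ> b)"
  using assms
  by (simp add: wreath_sym_def semidirect_product_def permute_residue_vector wreath_base_mult sym_group_def)

lemma group_wreath_sym: "group (wreath_sym p n)"
proof (rule groupI)
  fix x y assume "x \<in> carrier (wreath_sym p n)" "y \<in> carrier (wreath_sym p n)"
  then show "x \<otimes>\<^bsub>wreath_sym p n\<^esub> y \<in> carrier (wreath_sym p n)"
    by (elim wreath_sym_elem) (simp add: wreath_sym_mult, simp add: carrier_wreath_sym permutes_compose)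
next
  fix x y z
  assume "x \<in> carrier (wreath_sym p n)" "y \<in> carrier (wreath_sym p n)" "z \<in> carrier (wreath_sym p n)"
  then show "x \<otimes>\<^bsub>wreath_sym p n\<^esub> y \<otimes>\<^bsub>wreath_sym p n\<^esub> z =
      x \<otimes>\<^bsub>wreath_sym p n\<^esub> (y \<otimes>\<^bsub>wreath_sym p n\<^esub> z)"
    by (elim wreath_sym_elem)
      (simp add: wreath_sym_mult permutes_compose o_inv_distrib permutes_bij comp_assoc add.assoc)
next
  show "\<one>\<^bsub>wreath_sym p n\<^esub> \<in> carrier (wreath_sym p n)"
    by (simp add: wreath_sym_one carrier_wreath_sym)
next
  fix x assume "x \<in> carrier (wreath_sym p n)"
  then obtain f a where x: "x = (residue_vector p n f, a)" "a permutes {1..n}" by (rule wreath_sym_elem)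
  then show "\<one>\<^bsub>wreath_sym p n\<^esub> \<otimes>\<^bsub>wreath_sym p n\<^esub> x = x"
    by (simp add: wreath_sym_one wreath_sym_mult)
  show "\<exists>y\<in>carrier (wreath_sym p n). y \<otimes>\<^bsub>wreath_sym p n\<^esub> x = \<one>\<^bsub>wreath_sym p n\<^esub>"
    using x
    by (intro bexI[of _ "(residue_vector p n (\<lambda>k. - f (a k)), inv' a)"])
      (simp_all add: wreath_sym_one wreath_sym_mult permutes_inv permutes_inv_inv permutes_inv_o carrier_wreath_sym)
qed

lemma wreath_sym_inv:
  assumes "a permutes {1..n}"
  shows "inv\<^bsub>wreath_sym p n\<^esub> (residue_vector p n f, a) = (residue_vector p n (\<lambda>k. - f (a k)), inv' a)"
  using assms
  by (intro group.inv_equality[OF group_wreath_sym])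
    (simp_all add: wreath_sym_one wreath_sym_mult permutes_inv permutes_inv_inv permutes_inv_o carrier_wreath_sym)

text \<open>The base part \<open>f\<close> of the first element cancels, as the base is abelian: the commutator
  depends only on the permutation \<open>a\<close>.\<close>

lemma wreath_sym_commutator:
  assumes "a permutes {1..n}"
  shows "inv\<^bsub>wreath_sym p n\<^esub> (residue_vector p n f, a) \<otimes>\<^bsub>wreath_sym p n\<^esub>
      inv\<^bsub>wreath_sym p n\<^esub> (residue_vector p n g, id) \<otimes>\<^bsub>wreath_sym p n\<^esub>
      (residue_vector p n f, a) \<otimes>\<^bsub>wreath_sym p n\<^esub> (residue_vector p n g, id) =
    (residue_vector p n (\<lambda>k. g k - g (a k)), id)"
  using assms
  by (simp add: wreath_sym_inv wreath_sym_mult permutes_id permutes_inv permutes_inv_inv permutes_inv_o)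

lemma wreath_sym_conj:
  assumes "a permutes {1..n}"
  shows "(residue_vector p n f, a) \<otimes>\<^bsub>wreath_sym p n\<^esub> (residue_vector p n g, id) \<otimes>\<^bsub>wreath_sym p n\<^esub>
      inv\<^bsub>wreath_sym p n\<^esub> (residue_vector p n f, a) =
    (residue_vector p n (\<lambda>k. g (inv' a k)), id)"
  using assms
  by (simp add: wreath_sym_inv wreath_sym_mult permutes_inv_inv permutes_inv_o permutes_inverses)

end

lemma base_group_hom:
  assumes p0: "0 < p"
  shows "group_hom (wreath_base p n) (wreath_sym p n) (\<lambda>u. (u, id))"
proof -
  have "(u \<otimes>\<^bsub>wreath_base p n\<^esub> w, id) = (u, id) \<otimes>\<^bsub>wreath_sym p n\<^esub> (w, id)"
    if "u \<in> carrier (wreath_base p n)" "w \<in> carrier (wreath_base p n)" for u w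
    using wreath_base_mult[OF p0, of n u w] wreath_sym_mult[OF p0 permutes_id, of n u w id]
      residue_vector_carrier[OF p0 that(1)] residue_vector_carrier[OF p0 that(2)]
    by simp
  then show ?thesis
    using group_wreath_base[OF p0] group_wreath_sym[OF p0]
    by (auto simp: group_hom_def group_hom_axioms_def hom_def carrier_wreath_sym[OF p0] permutes_id)
qed

section \<open>The zero-sum submodule of the permutation module\<close>

text \<open>The symmetric group is 2-transitive.\<close>

lemma permutation_moving_pair:
  assumes "k \<in> S" "l \<in> S" "k' \<in> S" "l' \<in> S" "k \<noteq> l" "k' \<noteq> l'"
  shows "\<exists>a. a permutes S \<and> a k = k' \<and> a l = l'"
proof -
  (* m is where l ends up once k has been moved to k'. *)
  define m where "m = transpose k k' l"
  have m: "m \<in> S" "m \<noteq> k'"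
    using assms by (auto simp: m_def transpose_def)
  have "transpose m l' \<circ> transpose k k' permutes S"
    using assms m by (intro permutes_compose permutes_swap_id)
  moreover have "(transpose m l' \<circ> transpose k k') k = k'" "(transpose m l' \<circ> transpose k k') l = l'"
    using assms m by (auto simp: m_def)
  ultimately show ?thesis by blast
qed

text \<open>The vector \<open>c (e\<^sub>k - e\<^sub>l)\<close>, for \<open>k \<noteq> l\<close>.\<close>

definition root_vector :: "nat \<Rightarrow> nat \<Rightarrow> int \<Rightarrow> nat \<Rightarrow> int"
  where "root_vector k l c = (\<lambda>j. if j = k then c else if j = l then - c else 0)"

lemma sum_root_vector:
  assumes "k \<in> {1..n}" "l \<in> {1..n}" "k \<noteq> l"
  shows "(\<Sum>j=1..n. root_vector k l c j) = 0"
proof -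
  have "(\<Sum>j=1..n. root_vector k l c j) = (\<Sum>j\<in>{k,l}. root_vector k l c j)"
    using assms by (intro sum.mono_neutral_right) (auto simp: root_vector_def)
  then show ?thesis using assms by (simp add: root_vector_def)
qed

text \<open>The differences \<open>v - v \<circ> a\<close> arise as commutators of \<open>v\<close> with elements over \<open>a\<close>. For
  the transposition \<open>(k l)\<close> the difference is \<open>(v\<^sub>k - v\<^sub>l) (e\<^sub>k - e\<^sub>l)\<close>, whose coefficient is invertible
  modulo \<open>p\<close>. By 2-transitivity \<open>U\<close> then contains every \<open>c (e\<^sub>k - e\<^sub>l)\<close>, and these span the vectors
  of sum 0.\<close>

lemma zero_sum_vectors_subset_by_commutators:
  assumes p: "prime p"
    and U: "subgroup U (wreath_base p n)"
    and perm: "\<And>a u. a permutes {1..n} \<Longrightarrow> u \<in> U \<Longrightarrow> permute_coords n a u \<in> U"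
    and diff: "\<And>a. a permutes {1..n} \<Longrightarrow> residue_vector p n (\<lambda>k. v k - v (a k)) \<in> U"
    and kl: "k \<in> {1..n}" "l \<in> {1..n}" "\<not> [v k = v l] (mod int p)"
  shows "zero_sum_vectors p n \<subseteq> U"
proof -
  have p0: "0 < p" using p by (rule prime_gt_0_nat)
  have add: "residue_vector p n (\<lambda>j. f j + g j) \<in> U"
    if "residue_vector p n f \<in> U" "residue_vector p n g \<in> U" for f g
    using subgroup.m_closed[OF U that] by (simp add: wreath_base_mult[OF p0])
  have zero: "residue_vector p n (\<lambda>_. 0) \<in> U"
    using subgroup.one_closed[OF U] by (simp add: wreath_base_one[OF p0])
  have mult: "residue_vector p n (\<lambda>j. int m * f j) \<in> U" if "residue_vector p n f \<in> U" for f and m :: nat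
  proof (induction m)
    case (Suc m)
    then show ?case using add[OF that Suc] by (simp add: algebra_simps)
  qed (use zero in simp)
  have neq: "k \<noteq> l" using kl(3) by auto
  define c0 where "c0 = v k - v l"
  have c0: "residue_vector p n (root_vector k l c0) \<in> U"
  proof -
    have "(\<lambda>j. v j - v (transpose k l j)) = root_vector k l c0"
      by (auto simp: root_vector_def c0_def transpose_def)
    then show ?thesis
      using diff[OF permutes_swap_id[OF kl(1,2)]] by simp
  qed
  have "coprime c0 (int p)"
  proof -
    have "\<not> int p dvd c0"
      using kl(3) by (simp add: cong_iff_dvd_diff c0_def)
    then show ?thesis
      using p by (metis coprime_commute prime_imp_coprime prime_nat_int_transfer)
  qed
  then obtain b where b: "[c0 * b = 1] (mod int p)"
    using cong_solve_coprime_int by blast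
  have root: "residue_vector p n (root_vector k' l' c) \<in> U"
    if kl': "k' \<in> {1..n}" "l' \<in> {1..n}" "k' \<noteq> l'" for k' l' c
  proof -
    (* b inverts c0 modulo p, so multiplying by m turns the coefficient c0 into c. *)
    define m where "m = nat ((b * c) mod int p)"
    have m: "int m = (b * c) mod int p" using p0 by (simp add: m_def)
    have "[int m * c0 = b * c * c0] (mod int p)"
      unfolding m by (intro cong_mult cong_refl) (simp add: cong_def)
    also have "[b * c * c0 = c] (mod int p)"
      using cong_scalar_left[OF b, of c] by (simp add: mult_ac)
    finally have mc: "[int m * c0 = c] (mod int p)" .
    obtain a where a: "a permutes {1..n}" "a k = k'" "a l = l'"
      using permutation_moving_pair[OF kl(1,2) kl'(1,2) neq kl'(3)] by blast
    have inv_eq: "inv' a j = i \<longleftrightarrow> a i = j" for i j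
      by (rule permutes_inv_eq[OF a(1)])
    have "permute_coords n a (residue_vector p n (\<lambda>j. int m * root_vector k l c0 j)) \<in> U"
      by (rule perm[OF a(1) mult[OF c0]])
    then have "residue_vector p n (\<lambda>j. int m * root_vector k l c0 (inv' a j)) \<in> U"
      by (simp add: permute_residue_vector[OF p0 a(1)])
    also have "residue_vector p n (\<lambda>j. int m * root_vector k l c0 (inv' a j)) =
        residue_vector p n (root_vector k' l' c)"
      using mc cong_minus_minus_iff[of "int m * c0" c "int p"]
      by (auto simp: residue_vector_eq_iff root_vector_def inv_eq a)
    finally show ?thesis .
  qed
  (* Clear the last nonzero coordinate m against coordinate 1; a vector of sum 0 supported on
     coordinate 1 alone vanishes. *)
  have "residue_vector p n f \<in> U"
    if "int p dvd (\<Sum>j=1..n. f j)" "\<And>j. m < j \<Longrightarrow> f j = 0" "m \<le> n" for m and f :: "nat \<Rightarrow> int"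
    using that
  proof (induction m arbitrary: f)
    case 0
    then have "residue_vector p n f = residue_vector p n (\<lambda>_. 0)"
      by (simp add: residue_vector_eq_iff)
    then show ?case using zero by simp
  next
    case (Suc m)
    show ?case
    proof (cases "m = 0")
      case True
      have "(\<Sum>j=1..n. f j) = (\<Sum>j\<in>{1}. f j)"
        using Suc.prems True by (intro sum.mono_neutral_right) auto
      then have "[f 1 = 0] (mod int p)" using Suc.prems(1) by (simp add: cong_0_iff)
      moreover have "f j = 0" if "j \<in> {1..n}" "j \<noteq> 1" for j
        using Suc.prems(2)[of j] that True by simp
      ultimately have "residue_vector p n f = residue_vector p n (\<lambda>_. 0)"
        unfolding residue_vector_eq_iff by (metis cong_refl)
      then show ?thesis using zero by simp
    next
      case False
      define g where "g = (\<lambda>j. f j - root_vector (Suc m) 1 (f (Suc m)) j)"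
      have range: "Suc m \<in> {1..n}" "1 \<in> {1..n}" "Suc m \<noteq> 1" using False Suc.prems(3) by auto
      have "(\<Sum>j=1..n. g j) = (\<Sum>j=1..n. f j)"
        unfolding g_def sum_subtractf sum_root_vector[OF range] by simp
      moreover have "g j = 0" if "m < j" for j
        using Suc.prems(2)[of j] that False by (cases "j = Suc m") (auto simp: g_def root_vector_def)
      ultimately have "residue_vector p n g \<in> U"
        using Suc.IH[of g] Suc.prems by simp
      from add[OF root[OF range, of "f (Suc m)"] this] show ?thesis
        by (simp add: g_def)
    qed
  qed
  note supported = this
  show ?thesis
  proof
    fix x assume x: "x \<in> zero_sum_vectors p n"
    define f where "f = (\<lambda>j. if j \<in> {1..n} then x j else 0)"
    have xf: "x = residue_vector p n f"
    proof -
      have "residue_vector p n x = x"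
        using x residue_vector_carrier[OF p0] by (simp add: zero_sum_vectors_def)
      moreover have "residue_vector p n f = residue_vector p n x"
        by (simp add: f_def residue_vector_eq_iff)
      ultimately show ?thesis by simp
    qed
    then have "int p dvd (\<Sum>j=1..n. f j)"
      using x zero_sum_residue_vector_iff[OF p0] by simp
    then show "x \<in> U"
      unfolding xf by (rule supported[of f n]) (auto simp: f_def)
  qed
qed

text \<open>The vectors of sum 0 are the kernel of the coordinate sum, which takes values in a group of
  prime order. So they form a maximal subgroup.\<close>

lemma subgroup_containing_zero_sum_and_other:
  assumes p: "prime p" and U: "subgroup U (wreath_base p n)"
    and zs: "zero_sum_vectors p n \<subseteq> U"
    and f: "residue_vector p n f \<in> U" "\<not> int p dvd (\<Sum>k=1..n. f k)"
  shows "residue_vector p n g \<in> U"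
proof -
  have p0: "0 < p" using p by (rule prime_gt_0_nat)
  have add: "residue_vector p n (\<lambda>j. f j + g j) \<in> U"
    if "residue_vector p n f \<in> U" "residue_vector p n g \<in> U" for f g
    using subgroup.m_closed[OF U that] by (simp add: wreath_base_mult[OF p0])
  have mult: "residue_vector p n (\<lambda>j. int m * f j) \<in> U" for m :: nat
  proof (induction m)
    case 0
    then show ?case using subgroup.one_closed[OF U] by (simp add: wreath_base_one[OF p0])
  next
    case (Suc m)
    then show ?case using add[OF f(1) Suc] by (simp add: algebra_simps)
  qed
  define s where "s = (\<Sum>k=1..n. f k)"
  have "coprime s (int p)"
    using p f(2) unfolding s_def by (metis coprime_commute prime_imp_coprime prime_nat_int_transfer)
  then obtain b where b: "[s * b = 1] (mod int p)"
    using cong_solve_coprime_int by blast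
  define c where "c = (\<Sum>k=1..n. g k)"
  (* g - m f has sum 0, where s is the sum of f, c that of g, and b inverts s. *)
  define m where "m = nat ((b * c) mod int p)"
  have m: "int m = (b * c) mod int p" using p0 by (simp add: m_def)
  have "[int m * s = b * c * s] (mod int p)"
    unfolding m by (intro cong_mult cong_refl) (simp add: cong_def)
  also have "[b * c * s = c] (mod int p)"
    using cong_scalar_left[OF b, of c] by (simp add: mult_ac)
  finally have "int p dvd c - int m * s"
    using cong_sym cong_iff_dvd_diff by blast
  moreover have "(\<Sum>k=1..n. g k - int m * f k) = c - int m * s"
    by (simp add: c_def s_def sum_subtractf sum_distrib_left)
  ultimately have "residue_vector p n (\<lambda>k. g k - int m * f k) \<in> U"
    using zs zero_sum_residue_vector_iff[OF p0, of n "\<lambda>k. g k - int m * f k"] by auto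
  from add[OF this mult[of m]] show ?thesis by simp
qed

text \<open>A constant vector \<open>c\<close> has sum \<open>n c\<close>, and \<open>n\<close> is invertible modulo \<open>p\<close>; hence the base is the
  sum of \<open>V\<^sup>-\<close> and the constant vectors.\<close>

lemma exists_scalar_shift:
  assumes p: "prime p" and "\<not> p dvd n"
  shows "\<exists>c. int p dvd (\<Sum>k=1..n. f k - c)"
proof -
  have "coprime (int n) (int p)"
    using assms by (metis coprime_commute coprime_int_iff prime_imp_coprime)
  then obtain b where b: "[int n * b = 1] (mod int p)"
    using cong_solve_coprime_int by blast
  define s where "s = (\<Sum>k=1..n. f k)"
  have "[s = int n * (b * s)] (mod int p)"
    using cong_sym[OF cong_scalar_right[OF b, of s]] by (simp add: mult_ac)
  then have "int p dvd s - int n * (b * s)" by (simp add: cong_iff_dvd_diff)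
  moreover have "(\<Sum>k=1..n. f k - b * s) = s - int n * (b * s)"
    by (simp add: s_def sum_subtractf)
  ultimately show ?thesis by (intro exI[of _ "b * s"]) simp
qed

lemma nonconstant_if_sum_nonzero:
  assumes "p dvd n" "\<not> int p dvd (\<Sum>k=1..n. f k)"
  obtains k l where "k \<in> {1..n}" "l \<in> {1..n}" "\<not> [f k = f l] (mod int p)"
proof (rule ccontr)
  assume "\<not> thesis"
  with that have "[f k = f 1] (mod int p)" if "k \<in> {1..n}" for k
    using \<open>k \<in> {1..n}\<close> by (metis atLeastAtMost_iff le_refl le_trans)
  then have "[(\<Sum>k=1..n. f k) = (\<Sum>k=1..n. f 1)] (mod int p)"
    by (intro cong_sum)
  then show False
    using assms by (simp add: cong_dvd_iff)
qed

section \<open>Pronormality forces the zero-sum submodule\<close>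

text \<open>Modulo the normal subgroup \<open>N = V\<^sup>-\<close> the vector \<open>v\<close> is central, so \<open>\<langle>P, P\<^sup>v\<rangle> \<le> P N\<close> and
  \<open>x = h w\<close> with \<open>h \<in> P\<close> and \<open>w \<in> N\<close>. Then \<open>u = v - w\<close> normalises \<open>P\<close>, and its commutators with
  \<open>P\<close> lie in \<open>P\<close>. As \<open>p\<close> divides \<open>n\<close>, constant vectors have sum 0; but \<open>u\<close> has the nonzero sum of \<open>v\<close>,
  so it is not constant and its commutators generate \<open>V\<^sup>-\<close>.\<close>

lemma pronormal_element_forces_zero_sum:
  assumes p: "prime p" and p_dvd: "p dvd n"
    and P: "subgroup P (wreath_sym p n)"
    and full: "\<And>a. a permutes {1..n} \<Longrightarrow> \<exists>h\<in>P. snd h = a"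
    and v: "v \<in> carrier (wreath_base p n)" "v \<notin> zero_sum_vectors p n"
    and x: "x \<in> generate (wreath_sym p n) (P \<union> conj_set (wreath_sym p n) P (v, id))"
      "conj_set (wreath_sym p n) P x = conj_set (wreath_sym p n) P (v, id)"
  shows "zero_sum_vectors p n \<times> {id} \<subseteq> P"
proof -
  have p0: "0 < p" using p by (rule prime_gt_0_nat)
  let ?W = "wreath_sym p n"
  interpret W: group ?W using p0 by (rule group_wreath_sym)
  define N where "N = zero_sum_vectors p n \<times> {id :: nat \<Rightarrow> nat}"
  have zero_sum_carrier: "zero_sum_vectors p n \<subseteq> carrier (wreath_base p n)"
    by (auto simp: zero_sum_vectors_def)
  have PW: "P \<subseteq> carrier ?W" using P by (rule subgroup.subset)
  have NW: "N \<subseteq> carrier ?W"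
    using zero_sum_carrier by (auto simp: N_def carrier_wreath_sym[OF p0] permutes_id)
  have N_elem: "\<exists>g. y = (residue_vector p n g, id) \<and> int p dvd (\<Sum>k=1..n. g k)" if y: "y \<in> N" for y
  proof -
    obtain z where z: "y = (z, id)" "z \<in> zero_sum_vectors p n" using y by (auto simp: N_def)
    have "residue_vector p n z = z"
      using z(2) zero_sum_carrier residue_vector_carrier[OF p0] by blast
    then show ?thesis
      using z zero_sum_residue_vector_iff[OF p0, of n z] by (intro exI[of _ z]) simp
  qed
  have N_vec: "(residue_vector p n g, id) \<in> N \<longleftrightarrow> int p dvd (\<Sum>k=1..n. g k)" for g
    by (simp add: N_def zero_sum_residue_vector_iff[OF p0])
  have sum_perm: "(\<Sum>k=1..n. g (a k)) = (\<Sum>k=1..n. g k)" if "a permutes {1..n}" for a and g :: "nat \<Rightarrow> int"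
    using sum.permute[OF that, of g] by (simp add: comp_def)
  have "subgroup N ?W"
  proof (rule W.subgroupI[OF NW])
    show "N \<noteq> {}" using N_vec[of "\<lambda>_. 0"] by auto
    show "inv\<^bsub>?W\<^esub> y \<in> N" if "y \<in> N" for y
      using N_elem[OF that] by (auto simp: wreath_sym_inv[OF p0] permutes_id N_vec sum_negf)
    show "y \<otimes>\<^bsub>?W\<^esub> z \<in> N" if "y \<in> N" "z \<in> N" for y z
      using N_elem[OF that(1)] N_elem[OF that(2)]
      by (auto simp: wreath_sym_mult[OF p0] permutes_id N_vec sum.distrib)
  qed
  then have N: "normal N ?W"
  proof (rule W.normal_invI)
    fix y g assume y: "y \<in> N" and g: "g \<in> carrier ?W"
    obtain f where f: "y = (residue_vector p n f, id)" "int p dvd (\<Sum>k=1..n. f k)"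
      using N_elem[OF y] by blast
    obtain f' a where g': "g = (residue_vector p n f', a)" "a permutes {1..n}"
      using g by (rule wreath_sym_elem[OF p0])
    then show "g \<otimes>\<^bsub>?W\<^esub> y \<otimes>\<^bsub>?W\<^esub> inv\<^bsub>?W\<^esub> g \<in> N"
      using f g' sum_perm[OF permutes_inv[OF g'(2)], of f]
      by (simp add: wreath_sym_conj[OF p0] N_vec del: One_nat_def)
  qed
  have vW: "(v, id) \<in> carrier ?W" using v(1) by (simp add: carrier_wreath_sym[OF p0] permutes_id)
  have v_vec: "residue_vector p n v = v" using v(1) by (rule residue_vector_carrier[OF p0])
  have commutator: "inv\<^bsub>?W\<^esub> h \<otimes>\<^bsub>?W\<^esub> inv\<^bsub>?W\<^esub> (residue_vector p n g, id) \<otimes>\<^bsub>?W\<^esub> h \<otimes>\<^bsub>?W\<^esub> (residue_vector p n g, id) =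
      (residue_vector p n (\<lambda>k. g k - g (snd h k)), id)"
    if h: "h \<in> carrier ?W" for h g
  proof -
    obtain f a where "h = (residue_vector p n f, a)" "a permutes {1..n}"
      using h by (rule wreath_sym_elem[OF p0])
    then show ?thesis by (simp add: wreath_sym_commutator[OF p0])
  qed
  have PN: "subgroup (P <#>\<^bsub>?W\<^esub> N) ?W"
    using W.mult_norm_subgroup[OF N P] W.commut_normal[OF P N] by simp
  have "conj_set ?W P (v, id) \<subseteq> P <#>\<^bsub>?W\<^esub> N"
  proof
    fix y assume "y \<in> conj_set ?W P (v, id)"
    then obtain h where h: "h \<in> P" "y = inv\<^bsub>?W\<^esub> (v, id) \<otimes>\<^bsub>?W\<^esub> h \<otimes>\<^bsub>?W\<^esub> (v, id)"
      by (auto simp: conj_set_def)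
    have hW: "h \<in> carrier ?W" using h PW by blast
    have a: "snd h permutes {1..n}" using hW by (auto simp: carrier_wreath_sym[OF p0])
    have "y = h \<otimes>\<^bsub>?W\<^esub> (inv\<^bsub>?W\<^esub> h \<otimes>\<^bsub>?W\<^esub> inv\<^bsub>?W\<^esub> (v, id) \<otimes>\<^bsub>?W\<^esub> h \<otimes>\<^bsub>?W\<^esub> (v, id))"
      using hW vW h(2) by (simp add: W.m_assoc[symmetric])
    moreover have "inv\<^bsub>?W\<^esub> h \<otimes>\<^bsub>?W\<^esub> inv\<^bsub>?W\<^esub> (v, id) \<otimes>\<^bsub>?W\<^esub> h \<otimes>\<^bsub>?W\<^esub> (v, id) \<in> N"
      using commutator[OF hW, of v] sum_perm[OF a, of v]
      by (simp add: v_vec N_vec sum_subtractf del: One_nat_def)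
    ultimately show "y \<in> P <#>\<^bsub>?W\<^esub> N"
      using h(1) by (auto simp: set_mult_def)
  qed
  moreover have "P \<subseteq> P <#>\<^bsub>?W\<^esub> N"
  proof
    fix y assume y: "y \<in> P"
    then have "y = y \<otimes>\<^bsub>?W\<^esub> \<one>\<^bsub>?W\<^esub>" using PW by auto
    then show "y \<in> P <#>\<^bsub>?W\<^esub> N"
      using y subgroup.one_closed[OF normal_imp_subgroup[OF N]] by (auto simp: set_mult_def)
  qed
  ultimately have "x \<in> P <#>\<^bsub>?W\<^esub> N"
    using W.generate_subgroup_incl[OF _ PN] x(1) by blast
  then obtain h w where hw: "h \<in> P" "w \<in> N" "x = h \<otimes>\<^bsub>?W\<^esub> w" by (auto simp: set_mult_def)
  have wW: "w \<in> carrier ?W" and hW: "h \<in> carrier ?W" using hw NW PW by auto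
  obtain g where g: "w = (residue_vector p n g, id)" "int p dvd (\<Sum>k=1..n. g k)"
    using N_elem[OF hw(2)] by blast
  define u where "u = (\<lambda>k. v k - g k)"
  have u: "(v, id) \<otimes>\<^bsub>?W\<^esub> inv\<^bsub>?W\<^esub> w = (residue_vector p n u, id)"
    using wreath_sym_inv[OF p0 permutes_id, of n g] wreath_sym_mult[OF p0 permutes_id, of n v "\<lambda>k. - g k" id]
    by (simp add: g u_def v_vec)
  define y where "y = (residue_vector p n u, id :: nat \<Rightarrow> nat)"
  have yW: "y \<in> carrier ?W" by (simp add: y_def carrier_wreath_sym[OF p0] p0 permutes_id)
  have "conj_set ?W P w = conj_set ?W P (v, id)"
    using x(2) W.conj_set_mult[OF PW hW wW] W.conj_set_self[OF P hw(1)] hw(3) by simp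
  then have "conj_set ?W (conj_set ?W P (v, id)) (inv\<^bsub>?W\<^esub> w) = conj_set ?W (conj_set ?W P w) (inv\<^bsub>?W\<^esub> w)"
    by simp
  then have normalises: "conj_set ?W P y = P"
    using W.conj_set_mult[OF PW wW, of "inv\<^bsub>?W\<^esub> w"] W.conj_set_mult[OF PW vW, of "inv\<^bsub>?W\<^esub> w"]
      wW W.conj_set_one[OF PW] u by (simp add: y_def)
  have diff: "(residue_vector p n (\<lambda>k. u k - u (a k)), id) \<in> P" if a: "a permutes {1..n}" for a
  proof -
    obtain h where h: "h \<in> P" "snd h = a" using full[OF a] by blast
    have hW: "h \<in> carrier ?W" using h PW by blast
    have "inv\<^bsub>?W\<^esub> y \<otimes>\<^bsub>?W\<^esub> h \<otimes>\<^bsub>?W\<^esub> y \<in> P"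
      using normalises h(1) by (auto simp: conj_set_def)
    then have "inv\<^bsub>?W\<^esub> h \<otimes>\<^bsub>?W\<^esub> (inv\<^bsub>?W\<^esub> y \<otimes>\<^bsub>?W\<^esub> h \<otimes>\<^bsub>?W\<^esub> y) \<in> P"
      using h(1) subgroup.m_closed[OF P] subgroup.m_inv_closed[OF P] by blast
    also have "inv\<^bsub>?W\<^esub> h \<otimes>\<^bsub>?W\<^esub> (inv\<^bsub>?W\<^esub> y \<otimes>\<^bsub>?W\<^esub> h \<otimes>\<^bsub>?W\<^esub> y) =
        inv\<^bsub>?W\<^esub> h \<otimes>\<^bsub>?W\<^esub> inv\<^bsub>?W\<^esub> y \<otimes>\<^bsub>?W\<^esub> h \<otimes>\<^bsub>?W\<^esub> y"
      using hW yW by (simp add: W.m_assoc)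
    finally show ?thesis
      using commutator[OF hW, of u] h(2) by (simp add: y_def)
  qed
  have u_sum: "\<not> int p dvd (\<Sum>k=1..n. u k)"
  proof
    assume "int p dvd (\<Sum>k=1..n. u k)"
    then have "int p dvd (\<Sum>k=1..n. v k)"
      using g(2) by (simp add: u_def sum_subtractf dvd_diff_left_iff)
    then show False
      using v(2) v_vec zero_sum_residue_vector_iff[OF p0, of n v] by simp
  qed
  obtain k l where kl: "k \<in> {1..n}" "l \<in> {1..n}" "\<not> [u k = u l] (mod int p)"
    using p_dvd u_sum by (rule nonconstant_if_sum_nonzero)
  interpret base: group_hom "wreath_base p n" ?W "\<lambda>z. (z, id)"
    by (rule base_group_hom[OF p0])
  define U where "U = {z \<in> carrier (wreath_base p n). (z, id) \<in> P}"
  have "permute_coords n a z \<in> U" if a: "a permutes {1..n}" and z: "z \<in> U" for a z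
  proof -
    have z': "residue_vector p n z = z" "(z, id) \<in> P"
      using z residue_vector_carrier[OF p0] by (auto simp: U_def)
    obtain h where h: "h \<in> P" "snd h = a" using full[OF a] by blast
    obtain g where g: "h = (residue_vector p n g, a)"
    proof -
      have "h \<in> carrier ?W" using h(1) PW by blast
      then obtain g b where "h = (residue_vector p n g, b)" by (rule wreath_sym_elem[OF p0])
      with that h(2) show thesis by simp
    qed
    have "h \<otimes>\<^bsub>?W\<^esub> (residue_vector p n z, id) \<otimes>\<^bsub>?W\<^esub> inv\<^bsub>?W\<^esub> h \<in> P"
      using z' h(1) subgroup.m_closed[OF P] subgroup.m_inv_closed[OF P] by simp
    then show ?thesis
      using permute_residue_vector[OF p0 a, of z] wreath_sym_conj[OF p0 a, of g z] z'(1)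
      by (simp add: g U_def p0)
  qed
  moreover have "subgroup U (wreath_base p n)"
    unfolding U_def by (rule base.subgroup_preimage[OF P])
  moreover have "residue_vector p n (\<lambda>k. u k - u (a k)) \<in> U" if "a permutes {1..n}" for a
    using diff[OF that] by (simp add: U_def p0)
  ultimately have "zero_sum_vectors p n \<subseteq> U"
    using kl by (intro zero_sum_vectors_subset_by_commutators[OF p, where v = u])
  then show ?thesis by (auto simp: U_def)
qed

section \<open>Factors of a direct product\<close>

definition factor_embedding ::
  "'i set \<Rightarrow> ('i \<Rightarrow> ('a, 'b) monoid_scheme) \<Rightarrow> 'i \<Rightarrow> 'a \<Rightarrow> 'i \<Rightarrow> 'a"
  where "factor_embedding I F i a = (\<lambda>j\<in>I. if j = i then a else \<one>\<^bsub>F j\<^esub>)"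

lemma factor_embedding_apply [simp]:
  "j \<in> I \<Longrightarrow> factor_embedding I F i a j = (if j = i then a else \<one>\<^bsub>F j\<^esub>)"
  by (simp add: factor_embedding_def)

lemma factor_embedding_hom:
  assumes F: "\<And>j. j \<in> I \<Longrightarrow> group (F j)" and i: "i \<in> I"
  shows "group_hom (F i) (product_group I F) (factor_embedding I F i)"
proof -
  have "factor_embedding I F i \<in> hom (F i) (product_group I F)"
    using F i group.is_monoid[OF F]
    by (auto simp: hom_def factor_embedding_def restrict_def fun_eq_iff)
  then show ?thesis
    using F i by (simp add: group_hom_def group_hom_axioms_def)
qed

lemma projection_hom:
  assumes F: "\<And>j. j \<in> I \<Longrightarrow> group (F j)" and i: "i \<in> I"
  shows "group_hom (product_group I F) (F i) (\<lambda>g. g i)"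
  using assms by (auto simp: group_hom_def group_hom_axioms_def hom_def)

text \<open>An element of a finite direct product is the product of its components.\<close>

lemma in_subgroup_if_components_in_subgroup:
  assumes F: "\<And>j. j \<in> I \<Longrightarrow> group (F j)" and "finite I"
    and S: "subgroup S (product_group I F)"
    and x: "x \<in> carrier (product_group I F)"
    and comp: "\<And>i. i \<in> I \<Longrightarrow> factor_embedding I F i (x i) \<in> S"
  shows "x \<in> S"
proof -
  have "(\<lambda>j\<in>I. if j \<in> J then x j else \<one>\<^bsub>F j\<^esub>) \<in> S" if "finite J" "J \<subseteq> I" for J
    using that
  proof (induction J)
    case empty
    have "(\<lambda>j\<in>I. if j \<in> {} then x j else \<one>\<^bsub>F j\<^esub>) = \<one>\<^bsub>product_group I F\<^esub>"
      by auto
    then show ?case using subgroup.one_closed[OF S] by metis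
  next
    case (insert i J)
    have "(\<lambda>j\<in>I. if j \<in> insert i J then x j else \<one>\<^bsub>F j\<^esub>) =
        factor_embedding I F i (x i) \<otimes>\<^bsub>product_group I F\<^esub> (\<lambda>j\<in>I. if j \<in> J then x j else \<one>\<^bsub>F j\<^esub>)"
      using insert.hyps insert.prems x group.is_monoid[OF F]
      by (auto simp: fun_eq_iff restrict_def PiE_iff)
    moreover have "factor_embedding I F i (x i) \<otimes>\<^bsub>product_group I F\<^esub>
        (\<lambda>j\<in>I. if j \<in> J then x j else \<one>\<^bsub>F j\<^esub>) \<in> S"
      by (intro subgroup.m_closed[OF S] comp insert.IH) (use insert.prems in auto)
    ultimately show ?case by (simp only:)
  qed
  from this[OF \<open>finite I\<close> order_refl] have "(\<lambda>j\<in>I. x j) \<in> S"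
    by (simp add: restrict_def cong: if_cong)
  moreover have "(\<lambda>j\<in>I. x j) = x" using x by (simp add: PiE_iff extensional_restrict)
  ultimately show ?thesis by simp
qed

section \<open>Products of wreath products\<close>

locale wreath_family =
  fixes I :: "nat set" and p n :: "nat \<Rightarrow> nat"
  assumes finite_I: "finite I" and prime_p: "\<And>i. i \<in> I \<Longrightarrow> prime (p i)"
begin

abbreviation W :: "nat \<Rightarrow> ((nat \<Rightarrow> int) \<times> (nat \<Rightarrow> nat)) monoid"
  where "W i \<equiv> wreath_sym (p i) (n i)"

abbreviation G :: "(nat \<Rightarrow> (nat \<Rightarrow> int) \<times> (nat \<Rightarrow> nat)) monoid"
  where "G \<equiv> product_group I W"

abbreviation embed :: "nat \<Rightarrow> (nat \<Rightarrow> int) \<times> (nat \<Rightarrow> nat) \<Rightarrow> nat \<Rightarrow> (nat \<Rightarrow> int) \<times> (nat \<Rightarrow> nat)"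
  where "embed \<equiv> factor_embedding I W"

definition in_base :: "(nat \<Rightarrow> (nat \<Rightarrow> int) \<times> (nat \<Rightarrow> nat)) \<Rightarrow> bool"
  where "in_base g \<longleftrightarrow> g \<in> carrier G \<and> (\<forall>i\<in>I. snd (g i) = id)"

text \<open>Equivalently \<open>G = H V\<close> when \<open>H\<close> is a subgroup, with \<open>V\<close> the set of elements satisfying
  \<^const>\<open>in_base\<close>. It lets an arbitrary element of \<open>G\<close> be corrected by one of \<open>H\<close> so that it falls into
  the base.\<close>

definition covers_top :: "(nat \<Rightarrow> (nat \<Rightarrow> int) \<times> (nat \<Rightarrow> nat)) set \<Rightarrow> bool"
  where "covers_top H \<longleftrightarrow> (\<forall>g\<in>carrier G. \<exists>h\<in>H. \<forall>i\<in>I. snd (h i) = snd (g i))"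

lemma p_pos: "i \<in> I \<Longrightarrow> 0 < p i"
  using prime_p prime_gt_0_nat by blast

lemma group_W: "i \<in> I \<Longrightarrow> group (W i)"
  by (simp add: p_pos group_wreath_sym)

sublocale group G
  by (rule product_group) (rule group_W)

lemma proj_carrier: "g \<in> carrier G \<Longrightarrow> i \<in> I \<Longrightarrow> g i \<in> carrier (W i)"
  by auto

lemma base_elem:
  assumes "in_base v" "i \<in> I"
  shows "v i = (residue_vector (p i) (n i) (fst (v i)), id)"
proof -
  have "fst (v i) \<in> carrier (wreath_base (p i) (n i))"
    using assms proj_carrier by (force simp: in_base_def carrier_wreath_sym[OF p_pos])
  then show ?thesis
    using assms residue_vector_carrier[OF p_pos] by (auto simp: in_base_def prod_eq_iff)
qed

lemma embed_carrier: "i \<in> I \<Longrightarrow> a \<in> carrier (W i) \<Longrightarrow> embed i a \<in> carrier G"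
  by (rule group_hom.hom_closed[OF factor_embedding_hom[OF group_W]])

lemma base_carrier: "i \<in> I \<Longrightarrow> (residue_vector (p i) (n i) f, id) \<in> carrier (W i)"
  by (simp add: carrier_wreath_sym[OF p_pos] p_pos permutes_id)

lemma covers_factor:
  assumes "covers_top H" "i \<in> I" "a permutes {1..n i}"
  shows "\<exists>h\<in>H. snd (h i) = a \<and> (\<forall>j\<in>I. j \<noteq> i \<longrightarrow> snd (h j) = id)"
proof -
  have "embed i (residue_vector (p i) (n i) (\<lambda>_. 0), a) \<in> carrier G"
    using assms by (intro embed_carrier) (auto simp: carrier_wreath_sym[OF p_pos] p_pos)
  then obtain h where "h \<in> H" "\<forall>j\<in>I. snd (h j) = snd (embed i (residue_vector (p i) (n i) (\<lambda>_. 0), a) j)"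
    using assms(1) unfolding covers_top_def by blast
  then show ?thesis
    using assms(2) by (intro bexI[of _ h]) (auto simp: wreath_sym_one[OF p_pos])
qed

lemma commutator_apply:
  assumes h: "h \<in> carrier G" and v: "in_base v" and i: "i \<in> I"
  shows "(inv\<^bsub>G\<^esub> h \<otimes>\<^bsub>G\<^esub> inv\<^bsub>G\<^esub> v \<otimes>\<^bsub>G\<^esub> h \<otimes>\<^bsub>G\<^esub> v) i =
    (residue_vector (p i) (n i) (\<lambda>k. fst (v i) k - fst (v i) (snd (h i) k)), id)"
proof -
  obtain f a where fa: "h i = (residue_vector (p i) (n i) f, a)" "a permutes {1..n i}"
    using proj_carrier[OF h i] by (rule wreath_sym_elem[OF p_pos[OF i]])
  have v': "v \<in> carrier G" using v by (simp add: in_base_def)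
  have "(inv\<^bsub>G\<^esub> h \<otimes>\<^bsub>G\<^esub> inv\<^bsub>G\<^esub> v \<otimes>\<^bsub>G\<^esub> h \<otimes>\<^bsub>G\<^esub> v) i = inv\<^bsub>W i\<^esub> (h i) \<otimes>\<^bsub>W i\<^esub> inv\<^bsub>W i\<^esub> (v i) \<otimes>\<^bsub>W i\<^esub> h i \<otimes>\<^bsub>W i\<^esub> v i"
    using h v' i group_W by simp
  then show ?thesis
    using wreath_sym_commutator[OF p_pos[OF i] fa(2), of f "fst (v i)"] base_elem[OF v i] fa(1)
    by simp
qed

text \<open>The elements of \<open>H\<close> over a permutation of the \<open>i\<close>-th factor alone lie in the abelian base at
  all other factors, so their commutators with \<open>v\<close> live in the \<open>i\<close>-th factor. Hence the statement
  reduces to the permutation module of that factor, with \<open>U\<close> the part of it inside \<open>L\<close>.\<close>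

lemma zero_sum_subset_by_commutators:
  assumes L: "subgroup L G" "H \<subseteq> L" and full: "covers_top H"
    and v: "in_base v" and comm: "\<And>h. h \<in> H \<Longrightarrow> inv\<^bsub>G\<^esub> h \<otimes>\<^bsub>G\<^esub> inv\<^bsub>G\<^esub> v \<otimes>\<^bsub>G\<^esub> h \<otimes>\<^bsub>G\<^esub> v \<in> L"
    and i: "i \<in> I"
    and kl: "k \<in> {1..n i}" "l \<in> {1..n i}" "\<not> [fst (v i) k = fst (v i) l] (mod int (p i))"
    and w: "w \<in> zero_sum_vectors (p i) (n i)"
  shows "embed i (w, id) \<in> L"
proof -
  note p0 = p_pos[OF i]
  interpret E: group_hom "W i" G "embed i" by (rule factor_embedding_hom[OF group_W i])
  interpret B: group_hom "wreath_base (p i) (n i)" "W i" "\<lambda>u. (u, id)"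
    by (rule base_group_hom[OF p0])
  define U where "U = {u \<in> carrier (wreath_base (p i) (n i)). (u, id) \<in> {x \<in> carrier (W i). embed i x \<in> L}}"
  have LG: "L \<subseteq> carrier G" using L(1) by (rule subgroup.subset)
  have U: "residue_vector (p i) (n i) f \<in> U \<longleftrightarrow> embed i (residue_vector (p i) (n i) f, id) \<in> L" for f
    using base_carrier[OF i] by (simp add: U_def p0)
  have embed_eq: "x = embed i (residue_vector (p i) (n i) f, id)"
    if "x \<in> carrier G" "\<And>j. j \<in> I \<Longrightarrow> x j = (if j = i then (residue_vector (p i) (n i) f, id) else \<one>\<^bsub>W j\<^esub>)"
    for x f
    using that by (auto simp: factor_embedding_def PiE_iff extensional_def fun_eq_iff)
  have "subgroup U (wreath_base (p i) (n i))"
    unfolding U_def by (intro B.subgroup_preimage E.subgroup_preimage L)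
  moreover have "permute_coords (n i) a u \<in> U" if a: "a permutes {1..n i}" and u: "u \<in> U" for a u
  proof -
    have u': "residue_vector (p i) (n i) u = u" "embed i (u, id) \<in> L"
      using u residue_vector_carrier[OF p0] by (auto simp: U_def)
    obtain h where h: "h \<in> H" "snd (h i) = a" using covers_factor[OF full i a] by blast
    have hG: "h \<in> carrier G" using h L LG by blast
    obtain f where f: "h i = (residue_vector (p i) (n i) f, a)"
      using proj_carrier[OF hG i] h(2) wreath_sym_elem[OF p0] by (metis snd_conv)
    define c where "c = h \<otimes>\<^bsub>G\<^esub> embed i (u, id) \<otimes>\<^bsub>G\<^esub> inv\<^bsub>G\<^esub> h"
    have "c \<in> L"
      unfolding c_def
      by (intro subgroup.m_closed[OF L(1)] subgroup.m_inv_closed[OF L(1)]) (use h(1) L(2) u'(2) in auto)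
    moreover have "c = embed i (residue_vector (p i) (n i) (\<lambda>k. u (inv' a k)), id)"
    proof (rule embed_eq)
      show "c \<in> carrier G" using \<open>c \<in> L\<close> LG by blast
      fix j assume j: "j \<in> I"
      interpret Wj: group "W j" using j by (rule group_W)
      have "c j = h j \<otimes>\<^bsub>W j\<^esub> embed i (u, id) j \<otimes>\<^bsub>W j\<^esub> inv\<^bsub>W j\<^esub> (h j)"
        unfolding c_def using hG j group_W by simp
      then show "c j = (if j = i then (residue_vector (p i) (n i) (\<lambda>k. u (inv' a k)), id) else \<one>\<^bsub>W j\<^esub>)"
        using wreath_sym_conj[OF p0 a, of f u] proj_carrier[OF hG j] j u'(1) f by simp
    qed
    ultimately show ?thesis
      using permute_residue_vector[OF p0 a, of u] u'(1) by (simp add: U)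
  qed
  moreover have "residue_vector (p i) (n i) (\<lambda>k. fst (v i) k - fst (v i) (a k)) \<in> U"
    if a: "a permutes {1..n i}" for a
  proof -
    obtain h where h: "h \<in> H" "snd (h i) = a" "\<And>j. j \<in> I \<Longrightarrow> j \<noteq> i \<Longrightarrow> snd (h j) = id"
      using covers_factor[OF full i a] by blast
    have hG: "h \<in> carrier G" using h L LG by blast
    have "inv\<^bsub>G\<^esub> h \<otimes>\<^bsub>G\<^esub> inv\<^bsub>G\<^esub> v \<otimes>\<^bsub>G\<^esub> h \<otimes>\<^bsub>G\<^esub> v \<in> L" by (rule comm[OF h(1)])
    moreover have "inv\<^bsub>G\<^esub> h \<otimes>\<^bsub>G\<^esub> inv\<^bsub>G\<^esub> v \<otimes>\<^bsub>G\<^esub> h \<otimes>\<^bsub>G\<^esub> v =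
        embed i (residue_vector (p i) (n i) (\<lambda>k. fst (v i) k - fst (v i) (a k)), id)"
    proof (rule embed_eq)
      show "inv\<^bsub>G\<^esub> h \<otimes>\<^bsub>G\<^esub> inv\<^bsub>G\<^esub> v \<otimes>\<^bsub>G\<^esub> h \<otimes>\<^bsub>G\<^esub> v \<in> carrier G" using comm[OF h(1)] LG by blast
      show "(inv\<^bsub>G\<^esub> h \<otimes>\<^bsub>G\<^esub> inv\<^bsub>G\<^esub> v \<otimes>\<^bsub>G\<^esub> h \<otimes>\<^bsub>G\<^esub> v) j =
          (if j = i then (residue_vector (p i) (n i) (\<lambda>k. fst (v i) k - fst (v i) (a k)), id) else \<one>\<^bsub>W j\<^esub>)"
        if j: "j \<in> I" for j
        unfolding commutator_apply[OF hG v j] using h j by (simp add: wreath_sym_one[OF p_pos[OF j]])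
    qed
    ultimately show ?thesis by (simp add: U)
  qed
  ultimately have "zero_sum_vectors (p i) (n i) \<subseteq> U"
    using kl by (intro zero_sum_vectors_subset_by_commutators[OF prime_p[OF i], where v = "fst (v i)"])
  then show ?thesis using w by (auto simp: U_def)
qed

text \<open>Since \<open>h\<^sup>y = h [h, y]\<close>, conjugation by \<open>y\<close> maps \<open>H\<close> into itself as soon as the commutators \<open>[h, y]\<close>
  lie in \<open>H\<close>. Equality follows because the same holds for the inverse of \<open>y\<close>.\<close>

lemma conj_set_embed_base:
  assumes H: "subgroup H G" and i: "i \<in> I"
    and diff: "\<And>a. a permutes {1..n i} \<Longrightarrow> embed i (residue_vector (p i) (n i) (\<lambda>k. f k - f (a k)), id) \<in> H"
  shows "conj_set G H (embed i (residue_vector (p i) (n i) f, id)) = H"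
proof -
  note p0 = p_pos[OF i]
  interpret E: group_hom "W i" G "embed i" by (rule factor_embedding_hom[OF group_W i])
  have HG: "H \<subseteq> carrier G" using H by (rule subgroup.subset)
  have sub: "conj_set G H (embed i (residue_vector (p i) (n i) f, id)) \<subseteq> H"
    if diff: "\<And>a. a permutes {1..n i} \<Longrightarrow> embed i (residue_vector (p i) (n i) (\<lambda>k. f k - f (a k)), id) \<in> H" for f
  proof
    define y where "y = embed i (residue_vector (p i) (n i) f, id)"
    have yG: "y \<in> carrier G" unfolding y_def by (intro embed_carrier i base_carrier)
    have y: "in_base y"
      using yG i by (auto simp: in_base_def y_def wreath_sym_one[OF p_pos])
    fix z assume "z \<in> conj_set G H (embed i (residue_vector (p i) (n i) f, id))"
    then obtain h where h: "h \<in> H" "z = inv\<^bsub>G\<^esub> y \<otimes>\<^bsub>G\<^esub> h \<otimes>\<^bsub>G\<^esub> y" by (auto simp: conj_set_def y_def)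
    have hG: "h \<in> carrier G" using h HG by blast
    have a: "snd (h i) permutes {1..n i}"
      using proj_carrier[OF hG i] by (auto simp: carrier_wreath_sym[OF p0])
    have "inv\<^bsub>G\<^esub> h \<otimes>\<^bsub>G\<^esub> inv\<^bsub>G\<^esub> y \<otimes>\<^bsub>G\<^esub> h \<otimes>\<^bsub>G\<^esub> y = embed i (residue_vector (p i) (n i) (\<lambda>k. f k - f (snd (h i) k)), id)"
    proof (rule extensionalityI[of _ I])
      show "inv\<^bsub>G\<^esub> h \<otimes>\<^bsub>G\<^esub> inv\<^bsub>G\<^esub> y \<otimes>\<^bsub>G\<^esub> h \<otimes>\<^bsub>G\<^esub> y \<in> extensional I" by simp
      show "embed i (residue_vector (p i) (n i) (\<lambda>k. f k - f (snd (h i) k)), id) \<in> extensional I"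
        by (simp add: factor_embedding_def)
      fix j assume j: "j \<in> I"
      have fst_y: "fst (y j) = residue_vector (p j) (n j) (if j = i then f else (\<lambda>_. 0))"
        using j by (simp add: y_def wreath_sym_one[OF p_pos])
      have range: "snd (h j) k \<in> {1..n j}" if "k \<in> {1..n j}" for k
        using proj_carrier[OF hG j] permutes_in_image[of "snd (h j)" "{1..n j}" k] that
        by (auto simp: carrier_wreath_sym[OF p_pos[OF j]])
      have "residue_vector (p j) (n j) (\<lambda>k. fst (y j) k - fst (y j) (snd (h j) k)) =
          residue_vector (p j) (n j) (\<lambda>k. (if j = i then f else (\<lambda>_. 0)) k - (if j = i then f else (\<lambda>_. 0)) (snd (h j) k))"
        unfolding residue_vector_eq_iff fst_y
        using range by (auto simp: residue_vector_def cong_def mod_simps)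
      then show "(inv\<^bsub>G\<^esub> h \<otimes>\<^bsub>G\<^esub> inv\<^bsub>G\<^esub> y \<otimes>\<^bsub>G\<^esub> h \<otimes>\<^bsub>G\<^esub> y) j =
          embed i (residue_vector (p i) (n i) (\<lambda>k. f k - f (snd (h i) k)), id) j"
        unfolding commutator_apply[OF hG y j] using j by (simp add: wreath_sym_one[OF p_pos])
    qed
    then have "inv\<^bsub>G\<^esub> h \<otimes>\<^bsub>G\<^esub> inv\<^bsub>G\<^esub> y \<otimes>\<^bsub>G\<^esub> h \<otimes>\<^bsub>G\<^esub> y \<in> H" using diff[OF a] by simp
    then have "h \<otimes>\<^bsub>G\<^esub> (inv\<^bsub>G\<^esub> h \<otimes>\<^bsub>G\<^esub> inv\<^bsub>G\<^esub> y \<otimes>\<^bsub>G\<^esub> h \<otimes>\<^bsub>G\<^esub> y) \<in> H" using h(1) subgroup.m_closed[OF H] by blast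
    moreover have "h \<otimes>\<^bsub>G\<^esub> (inv\<^bsub>G\<^esub> h \<otimes>\<^bsub>G\<^esub> inv\<^bsub>G\<^esub> y \<otimes>\<^bsub>G\<^esub> h \<otimes>\<^bsub>G\<^esub> y) = z"
    proof -
      have "h \<otimes>\<^bsub>G\<^esub> (inv\<^bsub>G\<^esub> h \<otimes>\<^bsub>G\<^esub> inv\<^bsub>G\<^esub> y \<otimes>\<^bsub>G\<^esub> h \<otimes>\<^bsub>G\<^esub> y) = h \<otimes>\<^bsub>G\<^esub> inv\<^bsub>G\<^esub> h \<otimes>\<^bsub>G\<^esub> inv\<^bsub>G\<^esub> y \<otimes>\<^bsub>G\<^esub> h \<otimes>\<^bsub>G\<^esub> y"
        using hG yG by (simp only: m_assoc m_closed inv_closed)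
      then show ?thesis using hG yG h(2) by (simp only: r_inv l_one inv_closed)
    qed
    ultimately show "z \<in> H" by simp
  qed
  define y where "y = embed i (residue_vector (p i) (n i) f, id)"
  have yG: "y \<in> carrier G" unfolding y_def by (intro embed_carrier i base_carrier)
  have "embed i (residue_vector (p i) (n i) (\<lambda>k. - f k - - f (a k)), id) \<in> H" if "a permutes {1..n i}" for a
  proof -
    have "inv\<^bsub>G\<^esub> (embed i (residue_vector (p i) (n i) (\<lambda>k. f k - f (a k)), id)) =
        embed i (inv\<^bsub>W i\<^esub> (residue_vector (p i) (n i) (\<lambda>k. f k - f (a k)), id))"
      using base_carrier[OF i] by simp
    also have "inv\<^bsub>W i\<^esub> (residue_vector (p i) (n i) (\<lambda>k. f k - f (a k)), id) =
        (residue_vector (p i) (n i) (\<lambda>k. - f k - - f (a k)), id)"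
      by (simp add: wreath_sym_inv[OF p0 permutes_id])
    finally show ?thesis
      by (rule subst) (rule subgroup.m_inv_closed[OF H diff[OF that]])
  qed
  from sub[OF this] have "conj_set G H (embed i (residue_vector (p i) (n i) (\<lambda>k. - f k), id)) \<subseteq> H" .
  moreover have "embed i (residue_vector (p i) (n i) (\<lambda>k. - f k), id) = inv\<^bsub>G\<^esub> y"
    using E.hom_inv[OF base_carrier[OF i, of f]] by (simp add: y_def wreath_sym_inv[OF p0 permutes_id])
  ultimately have inv_sub: "conj_set G H (inv\<^bsub>G\<^esub> y) \<subseteq> H" by (simp del: inv_product_group)
  have "H = conj_set G (conj_set G H (inv\<^bsub>G\<^esub> y)) y"
    using conj_set_mult[OF HG inv_closed[OF yG] yG] conj_set_one[OF HG] l_inv[OF yG] by (simp only:)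
  also have "\<dots> \<subseteq> conj_set G H y"
    using inv_sub unfolding conj_set_def by (rule image_mono)
  finally show ?thesis
    using sub[OF diff] by (simp add: y_def)
qed

end

section \<open>Primitive groups containing a transposition\<close>

lemma conj_transpose:
  assumes "bij g"
  shows "g \<circ> transpose x y \<circ> inv' g = transpose (g x) (g y)"
proof
  fix z
  obtain w where z: "z = g w" using assms by (metis bij_pointE)
  have "inv' g z = w" using assms z by (simp add: bij_is_inj)
  then show "(g \<circ> transpose x y \<circ> inv' g) z = transpose (g x) (g y) z"
    using z inj_eq[OF bij_is_inj[OF assms]] by (auto simp: transpose_def)
qed

text \<open>Jordan's argument: the points \<open>x\<close> for which the transposition of \<open>k\<close> and \<open>x\<close> lies in \<open>T\<close> form
  a block of \<open>P\<close>, because \<open>T\<close> is normalised by \<open>P\<close>. The block contains \<open>k\<close> and \<open>l\<close>, so by primitivity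
  it is everything, and \<open>T\<close> contains all transpositions.\<close>

lemma primitive_subgroup_transposition_imp_all:
  assumes P: "primitive_subgroup P n"
    and id: "id \<in> T" and comp: "\<And>a b. a \<in> T \<Longrightarrow> b \<in> T \<Longrightarrow> a \<circ> b \<in> T"
    and conj: "\<And>g a. g \<in> P \<Longrightarrow> a \<in> T \<Longrightarrow> g \<circ> a \<circ> inv' g \<in> T"
    and kl: "k \<in> {1..n}" "l \<in> {1..n}" "k \<noteq> l" "transpose k l \<in> T"
    and a: "a permutes {1..n}"
  shows "a \<in> T"
proof -
  define R where "R x y \<longleftrightarrow> transpose x y \<in> T" for x y :: nat
  have R_sym: "R x y \<Longrightarrow> R y x" for x y by (simp add: R_def transpose_commute)
  have R_refl: "R x x" for x using id by (simp add: R_def)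
  have R_trans: "R x z" if "R x y" "R y z" for x y z
  proof (cases "x = z \<or> y = z")
    case True
    then show ?thesis using that R_refl by blast
  next
    case False
    then have "transpose x y \<circ> transpose y z \<circ> transpose x y = transpose x z"
      by (intro transpose_comp_triple) auto
    then show ?thesis using that comp unfolding R_def by metis
  qed
  have P_perm: "g permutes {1..n}" if "g \<in> P" for g
    using P that subgroup.mem_carrier by (fastforce simp: primitive_subgroup_def sym_group_def)
  have R_conj: "R (g x) (g y)" if "g \<in> P" "R x y" for g x y
    using conj[OF that(1)] that(2) conj_transpose[OF permutes_bij[OF P_perm[OF that(1)]]]
    unfolding R_def by metis
  define D where "D = {x \<in> {1..n}. R k x}"
  have block: "g ` D = D \<or> g ` D \<inter> D = {}" if g: "g \<in> P" for g
  proof (cases "g ` D \<inter> D = {}")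
    case False
    then obtain x where x: "x \<in> D" "g x \<in> D" by blast
    have k_gk: "R k (g k)"
      using x R_conj[OF g, of k x] R_sym R_trans unfolding D_def by blast
    have sub: "g ` D \<subseteq> D"
    proof
      fix z assume "z \<in> g ` D"
      then obtain y where y: "y \<in> D" "z = g y" by blast
      have "R k (g y)"
        using k_gk R_trans R_conj[OF g, of k y] y(1) unfolding D_def by blast
      moreover have "g y \<in> {1..n}"
        using y(1) permutes_in_image[OF P_perm[OF g], of y] unfolding D_def by blast
      ultimately show "z \<in> D" by (simp add: D_def y)
    qed
    have "finite D" by (simp add: D_def)
    moreover have "inj_on g D"
      using permutes_inj_on[OF P_perm[OF g]] .
    ultimately have "g ` D = D"
      using sub by (simp add: card_image card_subset_eq)
    then show ?thesis ..
  qed simp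
  have D: "D \<subseteq> {1..n}" "k \<in> D" "l \<in> D"
    using kl R_refl by (auto simp: D_def R_def)
  then have "\<not> is_singleton D" using kl(3) by (auto simp: is_singleton_def)
  moreover have "\<forall>D \<subseteq> {1..n}. D \<noteq> {} \<and> (\<forall>g \<in> P. g ` D = D \<or> g ` D \<inter> D = {}) \<longrightarrow>
      is_singleton D \<or> D = {1..n}"
    using P unfolding primitive_subgroup_def by (elim conjE)
  from spec[OF this, of D] have "is_singleton D \<or> D = {1..n}"
    using D(1,2) block by blast
  ultimately have "D = {1..n}" by simp
  then have R_all: "R x y" if "x \<in> {1..n}" "y \<in> {1..n}" for x y
    using that R_trans R_sym unfolding D_def by blast
  from a finite_atLeastAtMost show ?thesis
  proof (induction rule: permutes_induct)
    case (swap b c q)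
    then show ?case using R_all comp unfolding R_def by blast
  qed (rule id)
qed

section \<open>Subgroups of odd index cover the symmetric groups\<close>

context wreath_family
begin

definition top_map :: "(nat \<Rightarrow> (nat \<Rightarrow> int) \<times> (nat \<Rightarrow> nat)) \<Rightarrow> nat \<Rightarrow> nat \<Rightarrow> nat"
  where "top_map g = (\<lambda>i\<in>I. snd (g i))"

abbreviation B :: "(nat \<Rightarrow> nat \<Rightarrow> nat) monoid"
  where "B \<equiv> product_group I (\<lambda>i. sym_group (n i))"

lemma top_map_apply [simp]: "i \<in> I \<Longrightarrow> top_map g i = snd (g i)"
  by (simp add: top_map_def)

lemma snd_permutes: "g \<in> carrier G \<Longrightarrow> i \<in> I \<Longrightarrow> snd (g i) permutes {1..n i}"
  using proj_carrier[of g i] by (auto simp: carrier_wreath_sym[OF p_pos])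

lemma top_map_hom: "group_hom G B top_map"
proof -
  have "top_map g \<in> carrier B" if "g \<in> carrier G" for g
    using snd_permutes[OF that] by (auto simp: top_map_def sym_group_def)
  moreover have "top_map (g \<otimes>\<^bsub>G\<^esub> h) = top_map g \<otimes>\<^bsub>B\<^esub> top_map h" for g h
    by (auto simp: top_map_def wreath_sym_def semidirect_product_def split_beta)
  ultimately show ?thesis
    using sym_group_is_group is_group
    by (auto simp: group_hom_def group_hom_axioms_def hom_def)
qed

sublocale top: group_hom G B top_map
  by (rule top_map_hom)

lemma in_base_iff_kernel: "in_base g \<longleftrightarrow> g \<in> carrier G \<and> top_map g = \<one>\<^bsub>B\<^esub>"
  by (auto simp: in_base_def top_map_def sym_group_def fun_eq_iff restrict_def)

lemma top_map_eq_iff: "top_map g = top_map h \<longleftrightarrow> (\<forall>i\<in>I. snd (g i) = snd (h i))"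
  by (auto simp: top_map_def restrict_def fun_eq_iff)

lemma covers_top_if_top_map_surj:
  assumes "top_map ` H = carrier B"
  shows "covers_top H"
  unfolding covers_top_def
proof
  fix g assume "g \<in> carrier G"
  then have "top_map g \<in> top_map ` H" using assms top.hom_closed by simp
  then show "\<exists>h\<in>H. \<forall>i\<in>I. snd (h i) = snd (g i)" by (metis imageE top_map_eq_iff)
qed

lemma conj_factor_embedding_top_map:
  assumes h: "h \<in> carrier G"
  shows "top_map h \<otimes>\<^bsub>B\<^esub> factor_embedding I (\<lambda>i. sym_group (n i)) i b \<otimes>\<^bsub>B\<^esub> inv\<^bsub>B\<^esub> (top_map h) =
    factor_embedding I (\<lambda>i. sym_group (n i)) i (snd (h i) \<circ> b \<circ> inv' (snd (h i)))"
proof (rule extensionalityI[of _ I])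
  fix j assume j: "j \<in> I"
  have hj: "snd (h j) permutes {1..n j}" by (rule snd_permutes[OF h j])
  have "inv\<^bsub>sym_group (n j)\<^esub> snd (h j) = inv' (snd (h j))"
    using hj by (intro group.inv_equality[OF sym_group_is_group])
      (auto simp: sym_group_def permutes_inv_o permutes_inv)
  moreover have "top_map h \<in> carrier B" by (rule top.hom_closed[OF h])
  ultimately show "(top_map h \<otimes>\<^bsub>B\<^esub> factor_embedding I (\<lambda>i. sym_group (n i)) i b \<otimes>\<^bsub>B\<^esub> inv\<^bsub>B\<^esub> (top_map h)) j =
      factor_embedding I (\<lambda>i. sym_group (n i)) i (snd (h i) \<circ> b \<circ> inv' (snd (h i))) j"
    using j hj sym_group_is_group by simp (simp add: sym_group_def permutes_inv_o)
qed (simp_all add: factor_embedding_def)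

text \<open>For each factor, the permutations \<open>T\<close> of that factor that belong to the image of \<open>H\<close> form a
  subgroup normalised by the projection of the image, which is primitive. A conjugate in \<open>H\<close> of a
  transposition in that factor gives a transposition in \<open>T\<close>.\<close>

lemma top_map_surj_if_odd_index_primitive:
  assumes H: "subgroup H G" and odd: "odd (card (rcosets\<^bsub>G\<^esub> H))"
    and prim: "\<And>i. i \<in> I \<Longrightarrow> primitive_subgroup (snd ` (\<lambda>g. g i) ` H) (n i)"
  shows "top_map ` H = carrier B"
proof
  have HG: "H \<subseteq> carrier G" using H by (rule subgroup.subset)
  then show "top_map ` H \<subseteq> carrier B" using top.hom_closed by blast
  have S: "subgroup (top_map ` H) B" by (rule top.subgroup_img_is_subgroup[OF H])
  let ?e = "factor_embedding I (\<lambda>i. sym_group (n i))"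
  have all: "?e i a \<in> top_map ` H" if i: "i \<in> I" and a: "a permutes {1..n i}" for i a
  proof -
    interpret E: group_hom "sym_group (n i)" B "?e i"
      by (rule factor_embedding_hom[OF sym_group_is_group i])
    define T where "T = {a \<in> carrier (sym_group (n i)). ?e i a \<in> top_map ` H}"
    have T: "subgroup T (sym_group (n i))"
      unfolding T_def by (rule E.subgroup_preimage[OF S])
    have id: "id \<in> T" using subgroup.one_closed[OF T] by (simp add: sym_group_def)
    have comp: "b \<circ> c \<in> T" if "b \<in> T" "c \<in> T" for b c
      using subgroup.m_closed[OF T that] by (simp add: sym_group_def)
    have conj: "g \<circ> b \<circ> inv' g \<in> T" if "g \<in> snd ` (\<lambda>h. h i) ` H" and b: "b \<in> T" for g b
    proof -
      obtain h where h: "h \<in> H" "g = snd (h i)" using \<open>g \<in> _\<close> by blast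
      have hG: "h \<in> carrier G" using h HG by blast
      have g: "g permutes {1..n i}" using snd_permutes[OF hG i] h by simp
      have b': "b permutes {1..n i}" "?e i b \<in> top_map ` H"
        using b by (auto simp: T_def sym_group_def)
      have "top_map h \<otimes>\<^bsub>B\<^esub> ?e i b \<otimes>\<^bsub>B\<^esub> inv\<^bsub>B\<^esub> (top_map h) \<in> top_map ` H"
        using h(1) b'(2) by (intro subgroup.m_closed[OF S] subgroup.m_inv_closed[OF S]) auto
      then have "?e i (g \<circ> b \<circ> inv' g) \<in> top_map ` H"
        unfolding conj_factor_embedding_top_map[OF hG] h(2) .
      moreover have "g \<circ> b \<circ> inv' g permutes {1..n i}"
        using g b'(1) by (intro permutes_compose permutes_inv)
      ultimately show ?thesis by (simp add: T_def sym_group_def)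
    qed
    have "a \<in> T"
    proof (cases "n i \<ge> 2")
      case True
      define s where "s = embed i (residue_vector (p i) (n i) (\<lambda>_. 0), transpose 1 2)"
      have perm: "transpose 1 2 permutes {1..n i}"
        using True by (intro permutes_swap_id) auto
      have sW: "(residue_vector (p i) (n i) (\<lambda>_. 0), transpose 1 2) \<in> carrier (W i)"
        using perm by (simp add: carrier_wreath_sym[OF p_pos[OF i]] p_pos[OF i])
      interpret EW: group_hom "W i" G "embed i" by (rule factor_embedding_hom[OF group_W i])
      have sG: "s \<in> carrier G" unfolding s_def by (rule embed_carrier[OF i sW])
      have "s \<otimes>\<^bsub>G\<^esub> s = embed i ((residue_vector (p i) (n i) (\<lambda>_. 0), transpose 1 2) \<otimes>\<^bsub>W i\<^esub>
          (residue_vector (p i) (n i) (\<lambda>_. 0), transpose 1 2))"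
        unfolding s_def by (rule EW.hom_mult[OF sW sW, symmetric])
      also have "\<dots> = \<one>\<^bsub>G\<^esub>"
        using EW.hom_one by (simp add: wreath_sym_mult[OF p_pos[OF i] perm] wreath_sym_one[OF p_pos[OF i]]
            del: one_product_group One_nat_def)
      finally obtain g where g: "g \<in> carrier G" "g \<otimes>\<^bsub>G\<^esub> s \<otimes>\<^bsub>G\<^esub> inv\<^bsub>G\<^esub> g \<in> H"
        using involution_conj_in_odd_index_subgroup[OF H odd sG] by blast
      define b where "b = snd (g i)"
      have b: "b permutes {1..n i}" unfolding b_def by (rule snd_permutes[OF g(1) i])
      have "top_map s = ?e i (transpose 1 2)"
        by (rule extensionalityI[of _ I])
          (simp_all add: s_def top_map_def factor_embedding_def wreath_sym_one[OF p_pos] sym_group_one)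
      then have "top_map (g \<otimes>\<^bsub>G\<^esub> s \<otimes>\<^bsub>G\<^esub> inv\<^bsub>G\<^esub> g) =
          top_map g \<otimes>\<^bsub>B\<^esub> ?e i (transpose 1 2) \<otimes>\<^bsub>B\<^esub> inv\<^bsub>B\<^esub> (top_map g)"
        using top.hom_mult[OF m_closed[OF g(1) sG] inv_closed[OF g(1)]] top.hom_mult[OF g(1) sG]
          top.hom_inv[OF g(1)] by (simp only:)
      also have "\<dots> = ?e i (transpose (b 1) (b 2))"
        unfolding conj_factor_embedding_top_map[OF g(1)] b_def[symmetric]
          conj_transpose[OF permutes_bij[OF b]] ..
      finally have top: "top_map (g \<otimes>\<^bsub>G\<^esub> s \<otimes>\<^bsub>G\<^esub> inv\<^bsub>G\<^esub> g) = ?e i (transpose (b 1) (b 2))" .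
      have b12: "b 1 \<in> {1..n i}" "b 2 \<in> {1..n i}" "b 1 \<noteq> b 2"
        using True permutes_in_image[OF b, of 1] permutes_in_image[OF b, of 2]
          inj_eq[OF permutes_inj[OF b], of 1 2] by auto
      have "?e i (transpose (b 1) (b 2)) \<in> top_map ` H"
        unfolding top[symmetric] by (rule imageI[OF g(2)])
      then have "transpose (b 1) (b 2) \<in> T"
        using permutes_swap_id[OF b12(1,2)] by (simp add: T_def sym_group_carrier)
      then show ?thesis
        by (intro primitive_subgroup_transposition_imp_all[OF prim[OF i] id comp conj b12 _ a])
    next
      case False
      have "{1..n i} \<subseteq> {1}" using False by auto
      then have "a = id"
        using permutes_subset[OF a] by (metis permutes_sing)
      then show ?thesis using id by simp
    qed
    then show ?thesis by (simp add: T_def)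
  qed
  show "carrier B \<subseteq> top_map ` H"
  proof
    fix x assume x: "x \<in> carrier B"
    show "x \<in> top_map ` H"
      using x by (intro in_subgroup_if_components_in_subgroup[OF sym_group_is_group finite_I S x] all)
        (auto simp: sym_group_def PiE_iff)
  qed
qed

section \<open>A sufficient condition for pronormality\<close>

lemma snd_mult: "i \<in> I \<Longrightarrow> snd ((g \<otimes>\<^bsub>G\<^esub> h) i) = snd (g i) \<circ> snd (h i)"
  by (simp add: wreath_sym_def semidirect_product_def sym_group_def split_beta)

lemma in_base_left_quotient:
  assumes "h \<in> carrier G" "g \<in> carrier G" "\<And>i. i \<in> I \<Longrightarrow> snd (h i) = snd (g i)"
  shows "in_base (inv\<^bsub>G\<^esub> h \<otimes>\<^bsub>G\<^esub> g)"
proof -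
  have "top_map g = top_map h" using assms(3) by (simp add: top_map_eq_iff)
  then have "top_map (inv\<^bsub>G\<^esub> h \<otimes>\<^bsub>G\<^esub> g) = inv\<^bsub>B\<^esub> (top_map h) \<otimes>\<^bsub>B\<^esub> top_map h"
    using top.hom_mult[OF inv_closed[OF assms(1)] assms(2)] top.hom_inv[OF assms(1)] by (simp only:)
  also have "\<dots> = \<one>\<^bsub>B\<^esub>" by (rule top.H.l_inv[OF top.hom_closed[OF assms(1)]])
  finally show ?thesis
    unfolding in_base_iff_kernel using m_closed[OF inv_closed[OF assms(1)] assms(2)] by simp
qed

text \<open>Each component of \<open>v\<close> is split as \<open>y\<^sub>i x\<^sub>i\<close> with \<open>x\<^sub>i\<close> in \<open>\<langle>H, H\<^sup>v\<rangle>\<close> and \<open>y\<^sub>i\<close> normalising \<open>H\<close>.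
  A constant component goes to \<open>y\<close>, since it is central, and so does a component for which
  \<open>V\<^sub>i\<^sup>- \<le> H\<close>. Any other component is a constant plus a vector of sum 0, and the latter is in
  \<open>\<langle>H, H\<^sup>v\<rangle>\<close> because the component is not constant. Multiplying up, \<open>v = Y X\<close> and \<open>H\<^sup>v = H\<^sup>X\<close>.\<close>

lemma pronormal_element_exists:
  assumes H: "subgroup H G" and full: "covers_top H" and v: "in_base v"
    and comp: "\<And>i. i \<in> I \<Longrightarrow> (\<exists>c. int (p i) dvd (\<Sum>k=1..n i. fst (v i) k - c)) \<or>
      (\<forall>w\<in>zero_sum_vectors (p i) (n i). embed i (w, id) \<in> H)"
  shows "\<exists>x\<in>generate G (H \<union> conj_set G H v). conj_set G H x = conj_set G H v"
proof -
  define L where "L = generate G (H \<union> conj_set G H v)"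
  define N where "N = {y \<in> carrier G. conj_set G H y = H}"
  have HG: "H \<subseteq> carrier G" using H by (rule subgroup.subset)
  have vG: "v \<in> carrier G" using v by (simp add: in_base_def)
  have L: "subgroup L G"
    unfolding L_def using HG conj_set_subset_carrier[OF HG vG] by (intro generate_is_subgroup) blast
  have HL: "H \<subseteq> L" "conj_set G H v \<subseteq> L" unfolding L_def by (auto intro: generate.incl)
  have N: "subgroup N G" unfolding N_def by (rule subgroup_conj_stabilizer[OF HG])
  have comm: "inv\<^bsub>G\<^esub> h \<otimes>\<^bsub>G\<^esub> inv\<^bsub>G\<^esub> v \<otimes>\<^bsub>G\<^esub> h \<otimes>\<^bsub>G\<^esub> v \<in> L" if h: "h \<in> H" for h
  proof -
    have hG: "h \<in> carrier G" using h HG by blast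
    have "inv\<^bsub>G\<^esub> v \<otimes>\<^bsub>G\<^esub> h \<otimes>\<^bsub>G\<^esub> v \<in> L" using h HL(2) unfolding conj_set_def by blast
    then have "inv\<^bsub>G\<^esub> h \<otimes>\<^bsub>G\<^esub> (inv\<^bsub>G\<^esub> v \<otimes>\<^bsub>G\<^esub> h \<otimes>\<^bsub>G\<^esub> v) \<in> L"
      by (rule subgroup.m_closed[OF L subgroup.m_inv_closed[OF L subsetD[OF HL(1) h]]])
    then show ?thesis using hG vG by (simp only: m_assoc m_closed inv_closed)
  qed
  have decomposition: "\<exists>x y. x \<in> carrier (W i) \<and> y \<in> carrier (W i) \<and> v i = y \<otimes>\<^bsub>W i\<^esub> x \<and> embed i x \<in> L \<and> embed i y \<in> N"
    if i: "i \<in> I" for i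
  proof -
    note p0 = p_pos[OF i]
    let ?r = "residue_vector (p i) (n i)"
    interpret Wi: group "W i" by (rule group_W[OF i])
    interpret E: group_hom "W i" G "embed i" by (rule factor_embedding_hom[OF group_W i])
    define f where "f = fst (v i)"
    have vi: "v i = (?r f, id)" unfolding f_def by (rule base_elem[OF v i])
    have one: "embed i (?r (\<lambda>_. 0), id) \<in> S" if "subgroup S G" for S
      using subgroup.one_closed[OF that] E.hom_one wreath_sym_one[OF p0] by simp
    have N_I: "embed i (?r g, id) \<in> N"
      if "\<And>a. a permutes {1..n i} \<Longrightarrow> embed i (?r (\<lambda>k. g k - g (a k)), id) \<in> H" for g
      unfolding N_def using conj_set_embed_base[OF H i that] embed_carrier[OF i base_carrier[OF i]] by blast
    have only_y: ?thesis if "embed i (v i) \<in> N"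
    proof (rule exI[of _ "\<one>\<^bsub>W i\<^esub>"], rule exI[of _ "v i"], intro conjI)
      show "v i \<in> carrier (W i)" by (rule proj_carrier[OF vG i])
      then show "v i = v i \<otimes>\<^bsub>W i\<^esub> \<one>\<^bsub>W i\<^esub>" by simp
      show "embed i \<one>\<^bsub>W i\<^esub> \<in> L" using one[OF L] by (simp add: wreath_sym_one[OF p0])
    qed (use that in auto)
    show ?thesis
    proof (cases "\<forall>k\<in>{1..n i}. \<forall>l\<in>{1..n i}. [f k = f l] (mod int (p i))")
      case True
      have "embed i (?r f, id) \<in> N"
      proof (rule N_I)
        fix a assume a: "a permutes {1..n i}"
        have "?r (\<lambda>k. f k - f (a k)) = ?r (\<lambda>_. 0)"
          using True permutes_in_image[OF a] unfolding residue_vector_eq_iff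
          by (metis cong_diff_iff_cong_0)
        then show "embed i (?r (\<lambda>k. f k - f (a k)), id) \<in> H" using one[OF H] by simp
      qed
      then show ?thesis using only_y vi by simp
    next
      case False
      then obtain k l where kl: "k \<in> {1..n i}" "l \<in> {1..n i}" "\<not> [f k = f l] (mod int (p i))"
        by blast
      show ?thesis
        using comp[OF i]
      proof
        assume "\<exists>c. int (p i) dvd (\<Sum>k=1..n i. fst (v i) k - c)"
        then obtain c where c: "int (p i) dvd (\<Sum>k=1..n i. f k - c)" by (auto simp: f_def)
        have "embed i (?r (\<lambda>k. f k - c), id) \<in> L"
          by (rule zero_sum_subset_by_commutators[OF L HL(1) full v comm i kl(1,2)])
            (use kl(3) c in \<open>auto simp: f_def zero_sum_residue_vector_iff[OF p0]\<close>)
        moreover have "embed i (?r (\<lambda>_. c), id) \<in> N"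
          using one[OF H] by (intro N_I) simp
        moreover have "v i = (?r (\<lambda>_. c), id) \<otimes>\<^bsub>W i\<^esub> (?r (\<lambda>k. f k - c), id)"
          by (simp add: vi wreath_sym_mult[OF p0 permutes_id])
        ultimately show ?thesis using base_carrier[OF i] by blast
      next
        assume zs: "\<forall>w\<in>zero_sum_vectors (p i) (n i). embed i (w, id) \<in> H"
        have "embed i (?r f, id) \<in> N"
        proof (rule N_I)
          fix a assume a: "a permutes {1..n i}"
          have "(\<Sum>k=1..n i. f k - f (a k)) = 0"
            using sum.permute[OF a, of f] by (simp add: sum_subtractf comp_def)
          then show "embed i (?r (\<lambda>k. f k - f (a k)), id) \<in> H"
            using zs zero_sum_residue_vector_iff[OF p0, of "n i" "\<lambda>k. f k - f (a k)"] by simp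
        qed
        then show ?thesis using only_y vi by simp
      qed
    qed
  qed
  then have "\<forall>i\<in>I. \<exists>x y. x \<in> carrier (W i) \<and> y \<in> carrier (W i) \<and> v i = y \<otimes>\<^bsub>W i\<^esub> x \<and>
      embed i x \<in> L \<and> embed i y \<in> N" by blast
  from bchoice[OF this] obtain x where
    "\<forall>i\<in>I. \<exists>y. x i \<in> carrier (W i) \<and> y \<in> carrier (W i) \<and> v i = y \<otimes>\<^bsub>W i\<^esub> x i \<and>
      embed i (x i) \<in> L \<and> embed i y \<in> N" by blast
  from bchoice[OF this] obtain y where
    xy: "\<forall>i\<in>I. x i \<in> carrier (W i) \<and> y i \<in> carrier (W i) \<and> v i = y i \<otimes>\<^bsub>W i\<^esub> x i \<and>
      embed i (x i) \<in> L \<and> embed i (y i) \<in> N" by blast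
  define X where "X = (\<lambda>i\<in>I. x i)"
  define Y where "Y = (\<lambda>i\<in>I. y i)"
  have XG: "X \<in> carrier G" and YG: "Y \<in> carrier G" using xy by (auto simp: X_def Y_def)
  have X: "X \<in> L"
    by (rule in_subgroup_if_components_in_subgroup[OF group_W finite_I L XG]) (use xy in \<open>simp_all add: X_def\<close>)
  have Y: "Y \<in> N"
    by (rule in_subgroup_if_components_in_subgroup[OF group_W finite_I N YG]) (use xy in \<open>simp_all add: Y_def\<close>)
  have "v = Y \<otimes>\<^bsub>G\<^esub> X"
  proof (rule extensionalityI[of _ I])
    show "v \<in> extensional I" using vG by (auto simp: PiE_def)
  qed (use xy in \<open>simp_all add: X_def Y_def\<close>)
  then have "conj_set G H v = conj_set G (conj_set G H Y) X"
    using conj_set_mult[OF HG YG XG] by (simp only:)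
  also have "conj_set G H Y = H" using Y by (simp add: N_def)
  finally show ?thesis using X unfolding L_def by (intro bexI[of _ X]) simp_all
qed

text \<open>As \<open>g = h v\<close> with \<open>h \<in> H\<close> and \<open>v\<close> in the base, \<open>H\<^sup>g = H\<^sup>v\<close>.\<close>

lemma pronormal_in_subgroupI:
  assumes H: "subgroup H G" and full: "covers_top H"
    and K: "subgroup K G" "H \<subseteq> K"
    and comp: "\<And>v i. \<lbrakk>v \<in> K; in_base v; i \<in> I\<rbrakk> \<Longrightarrow>
      (\<exists>c. int (p i) dvd (\<Sum>k=1..n i. fst (v i) k - c)) \<or>
      (\<forall>w\<in>zero_sum_vectors (p i) (n i). embed i (w, id) \<in> H)"
  shows "pronormal H (G\<lparr>carrier := K\<rparr>)"
proof -
  have HG: "H \<subseteq> carrier G" using H by (rule subgroup.subset)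
  have KG: "K \<subseteq> carrier G" using K(1) by (rule subgroup.subset)
  have "\<exists>x\<in>generate G (H \<union> conj_set G H g). conj_set G H x = conj_set G H g" if g: "g \<in> K" for g
  proof -
    have gG: "g \<in> carrier G" using g KG by blast
    obtain h where h: "h \<in> H" "\<And>i. i \<in> I \<Longrightarrow> snd (h i) = snd (g i)"
      using full gG unfolding covers_top_def by blast
    have hG: "h \<in> carrier G" using h HG by blast
    define v where "v = inv\<^bsub>G\<^esub> h \<otimes>\<^bsub>G\<^esub> g"
    have v: "in_base v" unfolding v_def by (rule in_base_left_quotient[OF hG gG h(2)])
    have vK: "v \<in> K"
      unfolding v_def using g h(1) K by (intro subgroup.m_closed[OF K(1)] subgroup.m_inv_closed[OF K(1)]) auto
    have vG: "v \<in> carrier G" using vK KG by blast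
    have "g = h \<otimes>\<^bsub>G\<^esub> v"
      by (rule iffD1[OF inv_solve_left[OF vG hG gG] v_def])
    then have "conj_set G H g = conj_set G H v"
      using conj_set_mult[OF HG hG vG] conj_set_self[OF H h(1)] by (simp only:)
    then show ?thesis
      using pronormal_element_exists[OF H full v comp[OF vK v]] by simp
  qed
  then show ?thesis
    unfolding pronormal_in_subgroup_iff[OF K(1)] using H K(2) by blast
qed

section \<open>Pronormality and projections\<close>

lemma proj_subgroup:
  assumes "subgroup K G" "i \<in> I"
  shows "subgroup ((\<lambda>g. g i) ` K) (W i)"
proof -
  interpret pr: group_hom G "W i" "\<lambda>g. g i" by (rule projection_hom[OF group_W assms(2)])
  show ?thesis by (rule pr.subgroup_img_is_subgroup[OF assms(1)])
qed

lemma pronormal_proj: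
  assumes "subgroup K G" "pronormal H (G\<lparr>carrier := K\<rparr>)" "i \<in> I"
  shows "pronormal ((\<lambda>g. g i) ` H) ((W i)\<lparr>carrier := (\<lambda>g. g i) ` K\<rparr>)"
proof -
  interpret pr: group_hom G "W i" "\<lambda>g. g i" by (rule projection_hom[OF group_W assms(3)])
  show ?thesis by (rule pr.pronormal_img[OF assms(1,2)])
qed

lemma zero_sum_subset_proj_if_pronormal_proj:
  assumes H: "subgroup H G" and full: "covers_top H" and K: "subgroup K G" and i: "i \<in> I"
    and pro: "pronormal ((\<lambda>g. g i) ` H) ((W i)\<lparr>carrier := (\<lambda>g. g i) ` K\<rparr>)"
    and p_dvd: "p i dvd n i"
    and v: "v \<in> K" "in_base v" "\<not> int (p i) dvd (\<Sum>k=1..n i. fst (v i) k)"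
  shows "zero_sum_vectors (p i) (n i) \<times> {id} \<subseteq> (\<lambda>g. g i) ` H"
proof -
  note p0 = p_pos[OF i]
  interpret Wi: group "W i" by (rule group_W[OF i])
  let ?P = "(\<lambda>g. g i) ` H"
  have vi: "v i = (residue_vector (p i) (n i) (fst (v i)), id)" by (rule base_elem[OF v(2) i])
  then have rv: "residue_vector (p i) (n i) (fst (v i)) = fst (v i)" by (metis fst_conv)
  have "v i \<in> (\<lambda>g. g i) ` K" using v(1) by blast
  then have "(fst (v i), id) \<in> (\<lambda>g. g i) ` K" using vi rv by simp
  then obtain x where x: "x \<in> generate (W i) (?P \<union> conj_set (W i) ?P (fst (v i), id))"
    "conj_set (W i) ?P x = conj_set (W i) ?P (fst (v i), id)"
    using pro Wi.pronormal_in_subgroup_iff[OF proj_subgroup[OF K i]] by blast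
  have onto: "\<exists>y\<in>?P. snd y = a" if "a permutes {1..n i}" for a
    using covers_factor[OF full i that] by blast
  have "fst (v i) \<in> carrier (wreath_base (p i) (n i))"
    using residue_vector_in_carrier[OF p0, of "n i" "fst (v i)"] rv by simp
  moreover have "fst (v i) \<notin> zero_sum_vectors (p i) (n i)"
    using v(3) zero_sum_residue_vector_iff[OF p0, of "n i" "fst (v i)"] rv by simp
  ultimately show ?thesis
    by (intro pronormal_element_forces_zero_sum[OF prime_p[OF i] p_dvd proj_subgroup[OF H i] _ _ _ x] onto)
qed

text \<open>An element \<open>h \<in> H\<close> with \<open>i\<close>-th component \<open>e\<^sub>1 - e\<^sub>2\<close> may be non-trivial modulo the base in
  the other factors. Its commutator \<open>u\<close> with an element of \<open>H\<close> over the transposition \<open>(1 2)\<close> of the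
  \<open>i\<close>-th factor does lie in the base, since those two permutations are in different factors, and its
  \<open>i\<close>-th component is, up to sign, \<open>2 (e\<^sub>1 - e\<^sub>2)\<close>. For odd \<open>p\<close> this is not constant, even when \<open>n = 2\<close>, so the
  commutators of \<open>u\<close> with \<open>H\<close> generate \<open>V\<^sub>i\<^sup>-\<close>.\<close>

lemma zero_sum_subset_if_zero_sum_subset_proj:
  assumes H: "subgroup H G" and full: "covers_top H" and i: "i \<in> I"
    and odd: "odd (p i)" and n2: "2 \<le> n i"
    and proj: "zero_sum_vectors (p i) (n i) \<times> {id} \<subseteq> (\<lambda>g. g i) ` H"
    and w: "w \<in> zero_sum_vectors (p i) (n i)"
  shows "embed i (w, id) \<in> H"
proof -
  note p0 = p_pos[OF i]
  let ?r = "residue_vector (p i) (n i)"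
  have HG: "H \<subseteq> carrier G" using H by (rule subgroup.subset)
  have range: "1 \<in> {1..n i}" "2 \<in> {1..n i}" "(1::nat) \<noteq> 2" using n2 by auto
  have "?r (root_vector 1 2 1) \<in> zero_sum_vectors (p i) (n i)"
    unfolding zero_sum_residue_vector_iff[OF p0] sum_root_vector[OF range] by simp
  then have "(?r (root_vector 1 2 1), id) \<in> (\<lambda>g. g i) ` H" using proj by blast
  then obtain h where h: "h \<in> H" "h i = (?r (root_vector 1 2 1), id)" by auto
  obtain b where b: "b \<in> H" "snd (b i) = transpose 1 2" "\<And>j. j \<in> I \<Longrightarrow> j \<noteq> i \<Longrightarrow> snd (b j) = id"
    using covers_factor[OF full i permutes_swap_id[OF range(1,2)]] by blast
  have hG: "h \<in> carrier G" and bG: "b \<in> carrier G" using h(1) b(1) HG by auto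
  define u where "u = inv\<^bsub>G\<^esub> (h \<otimes>\<^bsub>G\<^esub> b) \<otimes>\<^bsub>G\<^esub> (b \<otimes>\<^bsub>G\<^esub> h)"
  have uH: "u \<in> H"
    unfolding u_def using h(1) b(1)
    by (intro subgroup.m_closed[OF H] subgroup.m_inv_closed[OF H])
  have u: "in_base u"
    unfolding u_def
  proof (rule in_base_left_quotient)
    show "snd ((h \<otimes>\<^bsub>G\<^esub> b) j) = snd ((b \<otimes>\<^bsub>G\<^esub> h) j)" if j: "j \<in> I" for j
      unfolding snd_mult[OF j] using h(2) b(3)[OF j] by (cases "j = i") simp_all
  qed (intro m_closed hG bG)+
  have uG: "u \<in> carrier G" using u by (simp add: in_base_def)
  obtain f where f: "b i = (?r f, transpose 1 2)"
    using wreath_sym_elem[OF p0 proj_carrier[OF bG i]] b(2) by (metis snd_conv)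
  have perm: "transpose 1 2 permutes {1..n i}" by (rule permutes_swap_id[OF range(1,2)])
  have "h \<otimes>\<^bsub>G\<^esub> b \<otimes>\<^bsub>G\<^esub> u = b \<otimes>\<^bsub>G\<^esub> h"
    by (rule sym[OF iffD1[OF inv_solve_left[OF uG m_closed[OF hG bG] m_closed[OF bG hG]] u_def]])
  then have "(h \<otimes>\<^bsub>G\<^esub> b \<otimes>\<^bsub>G\<^esub> u) i = (b \<otimes>\<^bsub>G\<^esub> h) i" by (simp only:)
  then have "h i \<otimes>\<^bsub>W i\<^esub> b i \<otimes>\<^bsub>W i\<^esub> u i = b i \<otimes>\<^bsub>W i\<^esub> h i" using i by simp
  then have eq: "?r (\<lambda>k. root_vector 1 2 1 k + f k + fst (u i) (transpose 1 2 k)) =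
      ?r (\<lambda>k. f k + root_vector 1 2 1 (transpose 1 2 k))"
    by (subst (asm) base_elem[OF u i]) (simp add: f h(2) wreath_sym_mult[OF p0] permutes_id perm del: One_nat_def)
  have shift: "[fst (u i) (transpose 1 2 k) = root_vector 1 2 1 (transpose 1 2 k) - root_vector 1 2 1 k] (mod int (p i))"
    if "k \<in> {1..n i}" for k
  proof -
    have "[root_vector 1 2 1 k + f k + fst (u i) (transpose 1 2 k) = f k + root_vector 1 2 1 (transpose 1 2 k)] (mod int (p i))"
      using eq that unfolding residue_vector_eq_iff by blast
    then show ?thesis by (simp add: cong_iff_dvd_diff algebra_simps)
  qed
  have "\<not> [fst (u i) 2 = fst (u i) 1] (mod int (p i))"
  proof
    assume "[fst (u i) 2 = fst (u i) 1] (mod int (p i))"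
    moreover have "[fst (u i) 2 = - 2] (mod int (p i))" "[fst (u i) 1 = 2] (mod int (p i))"
      using shift[OF range(1)] shift[OF range(2)] by (simp_all add: root_vector_def)
    ultimately have "[- 2 = 2] (mod int (p i))" by (metis cong_sym cong_trans)
    then have "int (p i) dvd int (2 * 2)" by (simp add: cong_iff_dvd_diff)
    then have "p i dvd 2" using prime_dvd_multD[OF prime_p[OF i]] int_dvd_int_iff by blast
    then show False using odd primes_dvd_imp_eq[OF prime_p[OF i] two_is_prime_nat] by simp
  qed
  moreover have "inv\<^bsub>G\<^esub> g \<otimes>\<^bsub>G\<^esub> inv\<^bsub>G\<^esub> u \<otimes>\<^bsub>G\<^esub> g \<otimes>\<^bsub>G\<^esub> u \<in> H" if "g \<in> H" for g
    using that uH by (intro subgroup.m_closed[OF H] subgroup.m_inv_closed[OF H])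
  ultimately show ?thesis
    by (intro zero_sum_subset_by_commutators[OF H order_refl full u _ i range(2,1) _ w])
qed

text \<open>From the projections to \<open>H\<close>: a component \<open>v\<^sub>i\<close> that is not a constant plus a vector of sum 0
  occurs only if \<open>p\<close> divides \<open>n\<close> and \<open>v\<^sub>i\<close> has nonzero sum. Then pronormality of the projection puts
  \<open>V\<^sub>i\<^sup>-\<close> into the projection of \<open>H\<close>, hence into \<open>H\<close>.\<close>

lemma pronormal_iff_pronormal_proj:
  assumes H: "subgroup H G" and full: "covers_top H"
    and odd: "\<And>i. i \<in> I \<Longrightarrow> odd (p i)"
    and K: "subgroup K G" "H \<subseteq> K"
  shows "pronormal H (G\<lparr>carrier := K\<rparr>) \<longleftrightarrow>
    (\<forall>i\<in>I. pronormal ((\<lambda>g. g i) ` H) ((W i)\<lparr>carrier := (\<lambda>g. g i) ` K\<rparr>))"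
proof
  assume "pronormal H (G\<lparr>carrier := K\<rparr>)"
  then show "\<forall>i\<in>I. pronormal ((\<lambda>g. g i) ` H) ((W i)\<lparr>carrier := (\<lambda>g. g i) ` K\<rparr>)"
    using pronormal_proj[OF K(1)] by blast
next
  assume pro: "\<forall>i\<in>I. pronormal ((\<lambda>g. g i) ` H) ((W i)\<lparr>carrier := (\<lambda>g. g i) ` K\<rparr>)"
  show "pronormal H (G\<lparr>carrier := K\<rparr>)"
  proof (rule pronormal_in_subgroupI[OF H full K])
    fix v i assume v: "v \<in> K" "in_base v" and i: "i \<in> I"
    show "(\<exists>c. int (p i) dvd (\<Sum>k=1..n i. fst (v i) k - c)) \<or>
      (\<forall>w\<in>zero_sum_vectors (p i) (n i). embed i (w, id) \<in> H)"
    proof (cases "p i dvd n i \<and> \<not> int (p i) dvd (\<Sum>k=1..n i. fst (v i) k)")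
      case True
      then have "n i \<noteq> 0" by (metis atLeastAtMost_iff dvd_0_right le_0_eq less_numeral_extra(1) not_less sum.neutral zero_less_one)
      then have "p i \<le> n i" using True dvd_imp_le by blast
      then have "2 \<le> n i" using prime_ge_2_nat[OF prime_p[OF i]] by linarith
      moreover have "zero_sum_vectors (p i) (n i) \<times> {id} \<subseteq> (\<lambda>g. g i) ` H"
        using zero_sum_subset_proj_if_pronormal_proj[OF H full K(1) i _ _ v] pro i True by blast
      ultimately show ?thesis
        using zero_sum_subset_if_zero_sum_subset_proj[OF H full i odd[OF i]] by blast
    next
      case False
      then consider "\<not> p i dvd n i" | "int (p i) dvd (\<Sum>k=1..n i. fst (v i) k)" by blast
      then show ?thesis
      proof cases
        case 1
        then show ?thesis using exists_scalar_shift[OF prime_p[OF i]] by blast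
      next
        case 2
        then show ?thesis by (intro disjI1 exI[of _ 0]) simp
      qed
    qed
  qed
qed

text \<open>The vector \<open>v\<close> is not constant, so \<open>V\<^sup>- \<le> K\<close> by commutators; as \<open>V\<^sup>-\<close> is maximal in \<open>V\<close>,
  \<open>K\<close> contains \<open>V\<close>, and \<open>G = H V\<close>.\<close>

lemma carrier_if_base_vector_of_nonzero_sum:
  assumes I: "I = {i}" and full: "covers_top H" and K: "subgroup K G" "H \<subseteq> K"
    and p_dvd: "p i dvd n i"
    and v: "v \<in> K" "in_base v" "\<not> int (p i) dvd (\<Sum>k=1..n i. fst (v i) k)"
  shows "K = carrier G"
proof
  have i: "i \<in> I" using I by simp
  note p0 = p_pos[OF i]
  show KG: "K \<subseteq> carrier G" using K(1) by (rule subgroup.subset)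
  interpret E: group_hom "W i" G "embed i" by (rule factor_embedding_hom[OF group_W i])
  interpret Bi: group_hom "wreath_base (p i) (n i)" "W i" "\<lambda>u. (u, id)"
    by (rule base_group_hom[OF p0])
  define U where "U = {u \<in> carrier (wreath_base (p i) (n i)). (u, id) \<in> {x \<in> carrier (W i). embed i x \<in> K}}"
  have U: "subgroup U (wreath_base (p i) (n i))"
    unfolding U_def by (intro Bi.subgroup_preimage E.subgroup_preimage K)
  have embed_eq: "embed i (residue_vector (p i) (n i) (fst (u i)), id) = u" if u: "in_base u" for u
  proof -
    have "u \<in> extensional I" using u by (auto simp: in_base_def PiE_def)
    then show ?thesis
      using base_elem[OF u i] by (auto simp: I factor_embedding_def extensional_def fun_eq_iff)
  qed
  obtain k l where kl: "k \<in> {1..n i}" "l \<in> {1..n i}" "\<not> [fst (v i) k = fst (v i) l] (mod int (p i))"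
    using p_dvd v(3) by (rule nonconstant_if_sum_nonzero)
  have comm: "inv\<^bsub>G\<^esub> h \<otimes>\<^bsub>G\<^esub> inv\<^bsub>G\<^esub> v \<otimes>\<^bsub>G\<^esub> h \<otimes>\<^bsub>G\<^esub> v \<in> K" if "h \<in> H" for h
    using that v(1) K by (intro subgroup.m_closed[OF K(1)] subgroup.m_inv_closed[OF K(1)]) auto
  have zs: "zero_sum_vectors (p i) (n i) \<subseteq> U"
  proof
    fix w assume w: "w \<in> zero_sum_vectors (p i) (n i)"
    then have "w \<in> carrier (wreath_base (p i) (n i))" by (simp add: zero_sum_vectors_def)
    then show "w \<in> U"
      using zero_sum_subset_by_commutators[OF K full v(2) comm i kl w] Bi.hom_closed by (simp add: U_def)
  qed
  have vU: "residue_vector (p i) (n i) (fst (v i)) \<in> U"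
    using v(1) embed_eq[OF v(2)] base_carrier[OF i] by (simp add: U_def p0)
  show "carrier G \<subseteq> K"
  proof
    fix g assume g: "g \<in> carrier G"
    then obtain h where h: "h \<in> H" "\<And>i. i \<in> I \<Longrightarrow> snd (h i) = snd (g i)"
      using full unfolding covers_top_def by blast
    have hK: "h \<in> K" using h(1) K(2) by blast
    have hG: "h \<in> carrier G" using hK KG by blast
    define u where "u = inv\<^bsub>G\<^esub> h \<otimes>\<^bsub>G\<^esub> g"
    have u: "in_base u" unfolding u_def by (rule in_base_left_quotient[OF hG g h(2)])
    then have uG: "u \<in> carrier G" by (simp add: in_base_def)
    have "residue_vector (p i) (n i) (fst (u i)) \<in> U"
      by (rule subgroup_containing_zero_sum_and_other[OF prime_p[OF i] U zs vU v(3)])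
    then have "u \<in> K" using embed_eq[OF u] by (simp add: U_def)
    moreover have "g = h \<otimes>\<^bsub>G\<^esub> u"
      by (rule iffD1[OF inv_solve_left[OF uG hG g] u_def])
    ultimately show "g \<in> K" using subgroup.m_closed[OF K(1) hK] by (simp only:)
  qed
qed

end

theorem theorem2:
  fixes t :: nat
    and p n :: "nat \<Rightarrow> nat"
    and G :: "(nat \<Rightarrow> (nat \<Rightarrow> int) \<times> (nat \<Rightarrow> nat)) monoid"
    and H :: "(nat \<Rightarrow> (nat \<Rightarrow> int) \<times> (nat \<Rightarrow> nat)) set"
  assumes G_def: "G = product_group {1..t} (\<lambda>i. wreath_sym (p i) (n i))"
    and t_pos: "1 \<le> t"
    and p_odd_prime: "\<And>i. i \<in> {1..t} \<Longrightarrow> prime (p i) \<and> odd (p i)"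
    and n_pos: "\<And>i. i \<in> {1..t} \<Longrightarrow> 1 \<le> n i"
    and H_subgroup: "subgroup H G"
    and H_nontrivial: "H \<noteq> {\<one>\<^bsub>G\<^esub>}"
    and H_odd_index: "odd (card (rcosets\<^bsub>G\<^esub> H))"
    and H_primitive: "\<And>i. i \<in> {1..t} \<Longrightarrow> primitive_subgroup (snd ` (\<lambda>g. g i) ` H) (n i)"
  shows
    "(\<lambda>g. \<lambda>i\<in>{1..t}. snd (g i)) ` H = carrier (product_group {1..t} (\<lambda>i. sym_group (n i)))
     \<and>
     (\<forall>K. subgroup K G \<and> H \<subseteq> K \<longrightarrow>
       (pronormal H (G\<lparr>carrier := K\<rparr>) \<longleftrightarrow>
        (\<forall>i\<in>{1..t}. pronormal ((\<lambda>g. g i) ` H)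
           ((wreath_sym (p i) (n i))\<lparr>carrier := (\<lambda>g. g i) ` K\<rparr>))))
     \<and>
     (t = 1 \<longrightarrow>
       (\<not> p 1 dvd n 1 \<longrightarrow> pronormal H G) \<and>
       (p 1 dvd n 1 \<longrightarrow>
         (pronormal H G \<longleftrightarrow> {g \<in> carrier G. g 1 \<in> wreath_base_minus (p 1) (n 1)} \<subseteq> H)) \<and>
       (\<forall>K. subgroup K G \<and> H \<subseteq> K \<and> K \<noteq> carrier G \<longrightarrow> pronormal H (G\<lparr>carrier := K\<rparr>)))"
proof -
  interpret wreath_family "{1..t}" p n
    using p_odd_prime by unfold_locales auto
  have odd: "odd (p i)" if "i \<in> {1..t}" for i using p_odd_prime that by blast
  have H: "subgroup H (product_group {1..t} (\<lambda>i. wreath_sym (p i) (n i)))"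
    using H_subgroup by (simp only: G_def)
  have HG: "H \<subseteq> carrier G" using H_subgroup by (rule subgroup.subset)
  have GG: "subgroup (carrier G) G" unfolding G_def by (rule subgroup_self)
  have top: "top_map ` H = carrier (product_group {1..t} (\<lambda>i. sym_group (n i)))"
    by (rule top_map_surj_if_odd_index_primitive[OF H H_odd_index[unfolded G_def] H_primitive])
  have top_eq: "top_map = (\<lambda>g. \<lambda>i\<in>{1..t}. snd (g i))" by (rule ext) (rule top_map_def)
  have full: "covers_top H" by (rule covers_top_if_top_map_surj[OF top])
  have part_ii: "pronormal H (G\<lparr>carrier := K\<rparr>) \<longleftrightarrow>
      (\<forall>i\<in>{1..t}. pronormal ((\<lambda>g. g i) ` H) ((wreath_sym (p i) (n i))\<lparr>carrier := (\<lambda>g. g i) ` K\<rparr>))"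
    if "subgroup K G" "H \<subseteq> K" for K
    unfolding G_def by (rule pronormal_iff_pronormal_proj[OF H full odd that[unfolded G_def]])
  have part_iii: "(\<not> p 1 dvd n 1 \<longrightarrow> pronormal H G) \<and>
       (p 1 dvd n 1 \<longrightarrow>
         (pronormal H G \<longleftrightarrow> {g \<in> carrier G. g 1 \<in> wreath_base_minus (p 1) (n 1)} \<subseteq> H)) \<and>
       (\<forall>K. subgroup K G \<and> H \<subseteq> K \<and> K \<noteq> carrier G \<longrightarrow> pronormal H (G\<lparr>carrier := K\<rparr>))"
    if t1: "t = 1"
  proof -
    have one: "1 \<in> {1..t}" and only: "\<And>i. i \<in> {1..t} \<Longrightarrow> i = 1" and single: "{1..t} = {1}"
      using t1 by auto
    have minus: "wreath_base_minus (p 1) (n 1) = zero_sum_vectors (p 1) (n 1) \<times> {id}"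
      by (simp add: wreath_base_minus_def zero_sum_vectors_def sym_group_one)
    have coprime_case: "pronormal H (G\<lparr>carrier := K\<rparr>)" if "subgroup K G" "H \<subseteq> K" "\<not> p 1 dvd n 1" for K
      unfolding G_def
    proof (rule pronormal_in_subgroupI[OF H full that(1,2)[unfolded G_def]])
      fix v i assume "i \<in> {1..t}"
      then have "i = 1" by (rule only)
      then show "(\<exists>c. int (p i) dvd (\<Sum>k=1..n i. fst (v i) k - c)) \<or>
          (\<forall>w\<in>zero_sum_vectors (p i) (n i). factor_embedding {1..t} (\<lambda>i. wreath_sym (p i) (n i)) i (w, id) \<in> H)"
        using exists_scalar_shift[OF prime_p[OF one] that(3)] by blast
    qed
    have "pronormal H G" if "\<not> p 1 dvd n 1"
      using coprime_case[OF GG HG that] by simp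
    moreover have "pronormal H G \<longleftrightarrow> {g \<in> carrier G. g 1 \<in> wreath_base_minus (p 1) (n 1)} \<subseteq> H"
      if p_dvd: "p 1 dvd n 1"
    proof
      assume "pronormal H G"
      then have "pronormal H (G\<lparr>carrier := carrier G\<rparr>)" by simp
      then have pro: "pronormal H ((product_group {1..t} (\<lambda>i. wreath_sym (p i) (n i)))\<lparr>carrier :=
          carrier (product_group {1..t} (\<lambda>i. wreath_sym (p i) (n i)))\<rparr>)"
        unfolding G_def .
      (* The unit vector e_1 has sum 1 and so lies outside the zero-sum submodule. *)
      define f :: "nat \<Rightarrow> int" where "f = (\<lambda>k. if k = 1 then 1 else 0)"
      define v where "v = factor_embedding {1..t} (\<lambda>i. wreath_sym (p i) (n i)) 1 (residue_vector (p 1) (n 1) f, id)"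
      have vG: "v \<in> carrier (product_group {1..t} (\<lambda>i. wreath_sym (p i) (n i)))"
        unfolding v_def by (rule embed_carrier[OF one base_carrier[OF one]])
      have v_base: "in_base v"
        unfolding in_base_def using vG by (auto simp: v_def wreath_sym_one[OF p_pos] simp del: carrier_product_group)
      have v1: "fst (v 1) = residue_vector (p 1) (n 1) f" using one by (simp add: v_def)
      have "(\<Sum>k=1..n 1. f k) = 1"
        using n_pos[OF one] by (simp add: f_def)
      then have "\<not> int (p 1) dvd (\<Sum>k=1..n 1. f k)"
        using prime_p[OF one] by (simp add: prime_nat_iff)
      moreover have "residue_vector (p 1) (n 1) (fst (v 1)) = residue_vector (p 1) (n 1) f"
        unfolding v1 residue_vector_eq_iff by (simp add: residue_vector_def)
      ultimately have "\<not> int (p 1) dvd (\<Sum>k=1..n 1. fst (v 1) k)"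
        using zero_sum_residue_vector_iff[OF p_pos[OF one], of "n 1"] by metis
      then have zs: "zero_sum_vectors (p 1) (n 1) \<times> {id} \<subseteq> (\<lambda>g. g 1) ` H"
        by (rule zero_sum_subset_proj_if_pronormal_proj[OF H full subgroup_self one
              pronormal_proj[OF subgroup_self pro one] p_dvd vG v_base])
      show "{g \<in> carrier G. g 1 \<in> wreath_base_minus (p 1) (n 1)} \<subseteq> H"
      proof
        fix g assume "g \<in> {g \<in> carrier G. g 1 \<in> wreath_base_minus (p 1) (n 1)}"
        then have g: "g \<in> carrier G" "g 1 \<in> (\<lambda>g. g 1) ` H" using zs minus by auto
        then obtain h where h: "h \<in> H" "g 1 = h 1" by blast
        have "g = h"
        proof (rule extensionalityI[of _ "{1..t}"])
          show "g \<in> extensional {1..t}" "h \<in> extensional {1..t}"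
            using g(1) h(1) HG by (auto simp: G_def PiE_def)
        qed (use h(2) only in metis)
        then show "g \<in> H" using h(1) by simp
      qed
    next
      assume sub: "{g \<in> carrier G. g 1 \<in> wreath_base_minus (p 1) (n 1)} \<subseteq> H"
      have "pronormal H (G\<lparr>carrier := carrier G\<rparr>)"
        unfolding G_def
      proof (rule pronormal_in_subgroupI[OF H full subgroup_self HG[unfolded G_def]])
        fix v i assume "i \<in> {1..t}"
        then have i: "i = 1" by (rule only)
        have "factor_embedding {1..t} (\<lambda>i. wreath_sym (p i) (n i)) 1 (w, id) \<in> H"
          if w: "w \<in> zero_sum_vectors (p 1) (n 1)" for w
        proof -
          have "(w, id) \<in> carrier (wreath_sym (p 1) (n 1))"
            using w by (simp add: zero_sum_vectors_def carrier_wreath_sym[OF p_pos[OF one]] permutes_id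
                del: One_nat_def)
          then have "factor_embedding {1..t} (\<lambda>i. wreath_sym (p i) (n i)) 1 (w, id) \<in> carrier G"
            unfolding G_def by (rule embed_carrier[OF one])
          then show ?thesis using sub w one minus by auto
        qed
        then show "(\<exists>c. int (p i) dvd (\<Sum>k=1..n i. fst (v i) k - c)) \<or>
          (\<forall>w\<in>zero_sum_vectors (p i) (n i). factor_embedding {1..t} (\<lambda>i. wreath_sym (p i) (n i)) i (w, id) \<in> H)"
          unfolding i by blast
      qed
      then show "pronormal H G" by simp
    qed
    moreover have "pronormal H (G\<lparr>carrier := K\<rparr>)"
      if K: "subgroup K G" "H \<subseteq> K" "K \<noteq> carrier G" for K
    proof (cases "p 1 dvd n 1")
      case True
      show ?thesis
        unfolding G_def
      proof (rule pronormal_in_subgroupI[OF H full K(1,2)[unfolded G_def]])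
        fix v i assume v: "v \<in> K" "in_base v" and "i \<in> {1..t}"
        then have i: "i = 1" by (intro only)
        have "int (p 1) dvd (\<Sum>k=1..n 1. fst (v 1) k)"
          using carrier_if_base_vector_of_nonzero_sum[OF single full K(1,2)[unfolded G_def] True v] K(3)
          unfolding G_def by blast
        then show "(\<exists>c. int (p i) dvd (\<Sum>k=1..n i. fst (v i) k - c)) \<or>
          (\<forall>w\<in>zero_sum_vectors (p i) (n i). factor_embedding {1..t} (\<lambda>i. wreath_sym (p i) (n i)) i (w, id) \<in> H)"
          unfolding i by (intro disjI1 exI[of _ 0]) simp
      qed
    qed (use coprime_case K in blast)
    ultimately show ?thesis by blast
  qed
  show ?thesis
    using top part_ii part_iii unfolding top_eq by blast
qed

end
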